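(* Let $m\ge 0$ be an integer. Let $M\subset H^2$ be a closed subspace that is nearly $S^*$-invariant with defect $m$, and let $F$ be an $m$-dimensional subspace of $H^2$, orthogonal to $M$, such that $S^*f\in M\oplus F$ whenever $f\in M$ and $f(0)=0$. Then: (i) In the case where there are functions in $M$ that do not vanish at $0$, $$M=\Big\{f:\ f(z)=k_0(z)f_0(z)+z\sum_{j=1}^m k_j(z)e_j(z):\ (k_0,\ldots,k_m)\in K\Big\},$$ where $f_0$ is the normalized reproducing kernel for $M$ at $0$, $\{e_1,\ldots,e_m\}$ is any orthonormal basis for $F$, and $K$ is a closed subspace of the vector-valued Hardy space $H^2(\mathbb{D};\mathbb{C}^{m+1})$ that is invariant under $S^*\oplus\cdots\oplus S^*$ ($m+1$ summands), and $\|f\|^2=\sum_{j=0}^m\|k_j\|^2$ for every $f$ represented in this way by $(k_0,\ldots,k_m)\in K$. (ii) In the case where all functions in $M$ vanish at $0$, $$M=\Big\{f:\ f(z)=z\sum_{j=1}^m k_j(z)e_j(z):\ (k_1,\ldots,k_m)\in K\Big\},$$ where $\{e_1,\ldots,e_m\}$ is any orthonormal basis for $F$ and $K$ is a closed subspace of $H^2(\mathbb{D};\mathbb{C}^{m})$ that is invariant under $S^*\oplus\cdots\oplus S^*$ ($m$ summands), and $\|f\|^2=\sum_{j=1}^m\|k_j\|^2$ for every $f$ represented in this way by $(k_1,\ldots,k_m)\in K$. Conversely, if a closed subspace $M\subset H^2$ has a representation as in (i) or (ii) (with $f_0$ in case (i) the normalized reproducing kernel for $M$ at $0$, $\{e_1,\dots,e_m\}$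 an orthonormal basis of some $m$-dimensional subspace $F$ of $H^2$ orthogonal to $M$, $K$ a closed $S^*\oplus\cdots\oplus S^*$-invariant subspace, and the stated norm identity), then $M$ is nearly $S^*$-invariant with defect $m$.
   Context: $H^2$ is the Hardy space of the open unit disc $\mathbb{D}$, and $S^*f(z)=(f(z)-f(0))/z$ is the backward shift on $H^2$, the adjoint of $Sf(z)=zf(z)$. A closed subspace $M\subset H^2$ is nearly $S^*$-invariant with defect $m$ if there is an $m$-dimensional subspace $F$ of $H^2$ (which may be taken to be orthogonal to $M$) such that if $f\in M$ and $f(0)=0$ then $S^*f\in M\oplus F$. (Here $m$ is not required to be minimal.) If some function of $M$ does not vanish at $0$, the normalized reproducing kernel for $M$ at $0$ is $f_0=\kappa_0/\|\kappa_0\|$, where $\kappa_0\in M$ is the element with $\langle f,\kappa_0\rangle=f(0)$ for all $f\in M$. $H^2(\mathbb{D};\mathbb{C}^n)$ is identified with the direct sum of $n$ copies of $H^2$, with $\|(k_1,\dots,k_n)\|^2=\sum_j\|k_j\|^2$, and $S^*\oplus\cdots\oplus S^*$ acts coordinatewise. Empty sums are zero. *)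

theory Defs
  imports "HOL-Complex_Analysis.Complex_Analysis" "HOL-Library.Function_Algebras"
begin

text \<open>
  Functions on the open unit disc are represented by total functions that vanish outside
  the disc, so that equality of functions is equality on the disc.
\<close>

definition taylor_coeff :: "(complex \<Rightarrow> complex) \<Rightarrow> nat \<Rightarrow> complex" where
  "taylor_coeff f n = (deriv ^^ n) f 0 / fact n"

definition H2 :: "(complex \<Rightarrow> complex) set" where
  "H2 = {f. f holomorphic_on ball 0 1 \<and> (\<forall>z. z \<notin> ball 0 1 \<longrightarrow> f z = 0) \<and>
            summable (\<lambda>n. (cmod (taylor_coeff f n))\<^sup>2)}"

definition H2_inner :: "(complex \<Rightarrow> complex) \<Rightarrow> (complex \<Rightarrow> complex) \<Rightarrow> complex" where
  "H2_inner f g = (\<Sum>n. taylor_coeff f n * cnj (taylor_coeff g n))"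

definition H2_norm :: "(complex \<Rightarrow> complex) \<Rightarrow> real" where
  "H2_norm f = sqrt (\<Sum>n. (cmod (taylor_coeff f n))\<^sup>2)"

text \<open>At \<open>z = 0\<close> the difference quotient is a removable singularity, with value \<open>f'(0)\<close>.\<close>

definition bshift :: "(complex \<Rightarrow> complex) \<Rightarrow> complex \<Rightarrow> complex" where
  "bshift f z = (if z \<in> ball 0 1 then (if z = 0 then deriv f 0 else (f z - f 0) / z) else 0)"

definition fscale :: "complex \<Rightarrow> (complex \<Rightarrow> complex) \<Rightarrow> complex \<Rightarrow> complex" where
  "fscale c f = (\<lambda>z. c * f z)"

global_interpretation H2fun: vector_space fscale
  by unfold_locales (auto simp: fscale_def fun_eq_iff algebra_simps)

definition H2_closed_subspace :: "(complex \<Rightarrow> complex) set \<Rightarrow> bool" where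
  "H2_closed_subspace M \<longleftrightarrow> M \<subseteq> H2 \<and> H2fun.subspace M \<and>
     (\<forall>X f. (\<forall>n. X n \<in> M) \<and> f \<in> H2 \<and> (\<lambda>n::nat. H2_norm (X n - f)) \<longlonglongrightarrow> 0 \<longrightarrow> f \<in> M)"

text \<open>
  The dimension is stated by a finite basis rather than by the constant \<open>dim\<close>, which is \<open>0\<close> also
  on infinite-dimensional spaces.
\<close>

definition H2_subspace_dim :: "nat \<Rightarrow> (complex \<Rightarrow> complex) set \<Rightarrow> bool" where
  "H2_subspace_dim m F \<longleftrightarrow> F \<subseteq> H2 \<and> H2fun.subspace F \<and>
     (\<exists>B. finite B \<and> card B = m \<and> H2fun.independent B \<and> H2fun.span B = F)"

definition H2_orthogonal :: "(complex \<Rightarrow> complex) set \<Rightarrow> (complex \<Rightarrow> complex) set \<Rightarrow> bool" where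
  "H2_orthogonal M F \<longleftrightarrow> (\<forall>f\<in>M. \<forall>g\<in>F. H2_inner f g = 0)"

definition H2_orthonormal_basis :: "nat \<Rightarrow> (nat \<Rightarrow> complex \<Rightarrow> complex) \<Rightarrow> (complex \<Rightarrow> complex) set \<Rightarrow> bool" where
  "H2_orthonormal_basis m e F \<longleftrightarrow>
     (\<forall>i\<in>{1..m}. \<forall>j\<in>{1..m}. H2_inner (e i) (e j) = (if i = j then 1 else 0)) \<and>
     H2fun.span (e ` {1..m}) = F"

definition bshift_into_sum :: "(complex \<Rightarrow> complex) set \<Rightarrow> (complex \<Rightarrow> complex) set \<Rightarrow> bool" where
  "bshift_into_sum M F \<longleftrightarrow> (\<forall>f\<in>M. f 0 = 0 \<longrightarrow> bshift f \<in> {g + h |g h. g \<in> M \<and> h \<in> F})"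

text \<open>
  The sum of \<open>M\<close> and \<open>F\<close> is required to be direct; orthogonality, which can always be achieved,
  is not part of the definition.
\<close>

definition nearly_invariant_defect :: "nat \<Rightarrow> (complex \<Rightarrow> complex) set \<Rightarrow> bool" where
  "nearly_invariant_defect m M \<longleftrightarrow> H2_closed_subspace M \<and>
     (\<exists>F. H2_subspace_dim m F \<and> M \<inter> F = {0} \<and> bshift_into_sum M F)"

text \<open>Meaningful for closed subspaces \<open>M\<close> containing a function that does not vanish at \<open>0\<close>.\<close>

definition kernel_at_0 :: "(complex \<Rightarrow> complex) set \<Rightarrow> complex \<Rightarrow> complex" where
  "kernel_at_0 M = (THE \<kappa>. \<kappa> \<in> M \<and> (\<forall>f\<in>M. H2_inner f \<kappa> = f 0))"

definition normalized_kernel_at_0 :: "(complex \<Rightarrow> complex) set \<Rightarrow> complex \<Rightarrow> complex" where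
  "normalized_kernel_at_0 M = (\<lambda>z. kernel_at_0 M z / of_real (H2_norm (kernel_at_0 M)))"

text \<open>
  The direct sum of copies of \<open>H2\<close> indexed by a finite set \<open>I\<close>; tuples are functions of the index
  that are zero outside \<open>I\<close>. The index sets used are \<open>{0..m}\<close> and \<open>{1..m}\<close>.
\<close>

definition H2_vec :: "nat set \<Rightarrow> (nat \<Rightarrow> complex \<Rightarrow> complex) set" where
  "H2_vec I = {k. (\<forall>j\<in>I. k j \<in> H2) \<and> (\<forall>j. j \<notin> I \<longrightarrow> k j = 0)}"

definition H2_vec_norm :: "nat set \<Rightarrow> (nat \<Rightarrow> complex \<Rightarrow> complex) \<Rightarrow> real" where
  "H2_vec_norm I k = sqrt (\<Sum>j\<in>I. (H2_norm (k j))\<^sup>2)"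

definition vscale :: "complex \<Rightarrow> (nat \<Rightarrow> complex \<Rightarrow> complex) \<Rightarrow> nat \<Rightarrow> complex \<Rightarrow> complex" where
  "vscale c k = (\<lambda>j. fscale c (k j))"

global_interpretation H2vec: vector_space vscale
  by unfold_locales (auto simp: vscale_def fscale_def fun_eq_iff algebra_simps)

definition H2_vec_closed_subspace :: "nat set \<Rightarrow> (nat \<Rightarrow> complex \<Rightarrow> complex) set \<Rightarrow> bool" where
  "H2_vec_closed_subspace I K \<longleftrightarrow> K \<subseteq> H2_vec I \<and> H2vec.subspace K \<and>
     (\<forall>X k. (\<forall>n. X n \<in> K) \<and> k \<in> H2_vec I \<and> (\<lambda>n::nat. H2_vec_norm I (X n - k)) \<longlonglongrightarrow> 0
            \<longrightarrow> k \<in> K)"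

definition bshift_invariant :: "(nat \<Rightarrow> complex \<Rightarrow> complex) set \<Rightarrow> bool" where
  "bshift_invariant K \<longleftrightarrow> (\<forall>k\<in>K. (\<lambda>j. bshift (k j)) \<in> K)"

definition rep_nonvanishing :: "nat \<Rightarrow> (complex \<Rightarrow> complex) \<Rightarrow> (nat \<Rightarrow> complex \<Rightarrow> complex) \<Rightarrow>
    (nat \<Rightarrow> complex \<Rightarrow> complex) \<Rightarrow> complex \<Rightarrow> complex" where
  "rep_nonvanishing m f0 e k = (\<lambda>z. k 0 z * f0 z + z * (\<Sum>j=1..m. k j z * e j z))"

definition rep_vanishing :: "nat \<Rightarrow> (nat \<Rightarrow> complex \<Rightarrow> complex) \<Rightarrow>
    (nat \<Rightarrow> complex \<Rightarrow> complex) \<Rightarrow> complex \<Rightarrow> complex" where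
  "rep_vanishing m e k = (\<lambda>z. z * (\<Sum>j=1..m. k j z * e j z))"

definition represents_nonvanishing :: "nat \<Rightarrow> (complex \<Rightarrow> complex) set \<Rightarrow>
    (nat \<Rightarrow> complex \<Rightarrow> complex) \<Rightarrow> (nat \<Rightarrow> complex \<Rightarrow> complex) set \<Rightarrow> bool" where
  "represents_nonvanishing m M e K \<longleftrightarrow>
     H2_vec_closed_subspace {0..m} K \<and> bshift_invariant K \<and>
     M = {rep_nonvanishing m (normalized_kernel_at_0 M) e k |k. k \<in> K} \<and>
     (\<forall>k\<in>K. (H2_norm (rep_nonvanishing m (normalized_kernel_at_0 M) e k))\<^sup>2
              = (\<Sum>j=0..m. (H2_norm (k j))\<^sup>2))"

definition represents_vanishing :: "nat \<Rightarrow> (complex \<Rightarrow> complex) set \<Rightarrow>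
    (nat \<Rightarrow> complex \<Rightarrow> complex) \<Rightarrow> (nat \<Rightarrow> complex \<Rightarrow> complex) set \<Rightarrow> bool" where
  "represents_vanishing m M e K \<longleftrightarrow>
     H2_vec_closed_subspace {1..m} K \<and> bshift_invariant K \<and>
     M = {rep_vanishing m e k |k. k \<in> K} \<and>
     (\<forall>k\<in>K. (H2_norm (rep_vanishing m e k))\<^sup>2 = (\<Sum>j=1..m. (H2_norm (k j))\<^sup>2))"

end

(* A function f in M splits as f = c_0 f_0 + z (c_1 e_1 + ... + c_m e_m) + z (R f) with R f again in M
   and |f|^2 = |c_0|^2 + ... + |c_m|^2 + |R f|^2, so iterating produces the Taylor coefficients of
   k_0, ..., k_m, and |f|^2 - (|k_0|^2 + ... + |k_m|^2) is the limit of |R^n f|^2. The point is that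
   this limit is 0. Write B for the backward shift. R extends to a finite rank perturbation
   R x = B x - (sum of <x, d_j> v_j) on all of H2 for which |x|^2 - |R x|^2 is the sum of the
   |<x, d_j>|^2.

   Suppose first that the sequence <R^n f, f> is square summable, and let h(w) = (1 - w R)^{-1} f for
   |w| = r < 1. The mean of I(w) = (1 - r^2) |h(w)|^2 over the circle is at least the limit of
   |R^n f|^2, and I(w) is at most 2 |<h(w), f>|, which is bounded in L^2. On the other hand
   h(w) = (1 - w B)^{-1} (f - w (sum of <h(w), d_j> v_j)), and (1 - r^2) times the mean of
   |(1 - w B)^{-1} v|^2 tends to 0 as r tends to 1, because B^n v tends to 0. So the mean of the
   square root of I tends to 0, and with the L^2 bound so does the mean of I.

   Every f = R*^N d_j has this property, and a vector z orthogonal to all of these satisfies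
   R^n z = B^n z and |R^n z| = |z|, hence z = 0. *)
theory Submission
  imports Defs "HOL-Real_Asymp.Real_Asymp"
begin

section \<open>The Hilbert space of square summable sequences\<close>

text \<open>The powers of a contraction need not tend to 0, even if it is a finite rank perturbation
  of B: the map taking (x_0, x_1, x_2, ...) to (x_0, x_2, x_3, ...) is one and fixes a unit vector.
  What excludes it is that the same functionals <., d_j> drive the perturbation and measure the loss
  of norm. By Parseval's identity this loss bounds <h(w), d_j> in L^2 of the circle |w| = r by |f|,
  whatever r is, and so the products <h(w), d_j> (1 - w B)^{-1} v_j become small in mean. That
  controls only the square root of I and leaves room for concentration on short arcs, which the L^2
  bound on <h(w), f> rules out. For f = R*^N d_j this bound comes from <R^n f, f> = <R^(n+N) f,
  d_j>, again a tail of a series of losses. The vectors with R^n x -> 0 form a closed subspace,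
  since all powers of R are contractions, so only its orthogonal complement is left to examine. The
  analysis is done on Taylor coefficients, made into a type so that the type classes for inner
  products and completeness apply; functions on the disc return in the last section.\<close>

typedef ell2 = "{a :: nat \<Rightarrow> complex. summable (\<lambda>n. (cmod (a n))\<^sup>2)}"
  morphisms coord Abs_ell2
  by (rule exI[of _ "\<lambda>_. 0"]) simp

setup_lifting type_definition_ell2

lemma ell2_eqI: "(\<And>n. coord x n = coord y n) \<Longrightarrow> x = y"
  by (metis coord_inject ext)

lemma summable_coord: "summable (\<lambda>n. (cmod (coord x n))\<^sup>2)"
  using coord[of x] by simp

lemma summable_cmod2_add:
  fixes a b :: "nat \<Rightarrow> complex"
  assumes "summable (\<lambda>n. (cmod (a n))\<^sup>2)" "summable (\<lambda>n. (cmod (b n))\<^sup>2)"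
  shows "summable (\<lambda>n. (cmod (a n + b n))\<^sup>2)"
proof (rule summable_comparison_test'[where N = 0])
  show "summable (\<lambda>n. 2 * (cmod (a n))\<^sup>2 + 2 * (cmod (b n))\<^sup>2)"
    using assms by (intro summable_add summable_mult)
  fix n
  have "(cmod (a n + b n))\<^sup>2 \<le> (cmod (a n) + cmod (b n))\<^sup>2"
    by (intro power_mono norm_triangle_ineq) auto
  also have "\<dots> \<le> 2 * (cmod (a n))\<^sup>2 + 2 * (cmod (b n))\<^sup>2"
    using sum_squares_bound[of "cmod (a n)" "cmod (b n)"] by (simp add: power2_sum)
  finally show "norm ((cmod (a n + b n))\<^sup>2) \<le> 2 * (cmod (a n))\<^sup>2 + 2 * (cmod (b n))\<^sup>2"
    by simp
qed

lift_definition cscale :: "complex \<Rightarrow> ell2 \<Rightarrow> ell2" is "\<lambda>c a n. c * a n"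
  by (simp add: norm_mult power_mult_distrib summable_mult)

definition cinner :: "ell2 \<Rightarrow> ell2 \<Rightarrow> complex" where
  "cinner x y = (\<Sum>n. coord x n * cnj (coord y n))"

lemma summable_cinner: "summable (\<lambda>n. coord x n * cnj (coord y n))"
proof (rule summable_comparison_test'[where N = 0])
  show "summable (\<lambda>n. (cmod (coord x n))\<^sup>2 + (cmod (coord y n))\<^sup>2)"
    by (intro summable_add summable_coord)
  show "norm (coord x n * cnj (coord y n)) \<le> (cmod (coord x n))\<^sup>2 + (cmod (coord y n))\<^sup>2" for n
    using sum_squares_bound[of "cmod (coord x n)" "cmod (coord y n)"]
      mult_nonneg_nonneg[OF norm_ge_zero[of "coord x n"] norm_ge_zero[of "coord y n"]]
    unfolding norm_mult complex_mod_cnj mult.assoc by linarith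
qed

text \<open>The class structure is that of a real inner product space, with the real part of
  \<open>cinner\<close> as inner product. The complex structure is carried alongside by
  \<open>cscale\<close> and \<open>cinner\<close>.\<close>

instantiation ell2 :: real_inner
begin

lift_definition zero_ell2 :: ell2 is "\<lambda>_. 0" by simp

lift_definition plus_ell2 :: "ell2 \<Rightarrow> ell2 \<Rightarrow> ell2" is "\<lambda>a b n. a n + b n"
  by (rule summable_cmod2_add)

lift_definition uminus_ell2 :: "ell2 \<Rightarrow> ell2" is "\<lambda>a n. - a n" by simp

lift_definition minus_ell2 :: "ell2 \<Rightarrow> ell2 \<Rightarrow> ell2" is "\<lambda>a b n. a n - b n"
proof -
  fix a b :: "nat \<Rightarrow> complex"
  assume "summable (\<lambda>n. (cmod (a n))\<^sup>2)" "summable (\<lambda>n. (cmod (b n))\<^sup>2)"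
  then show "summable (\<lambda>n. (cmod (a n - b n))\<^sup>2)"
    using summable_cmod2_add[of a "\<lambda>n. - b n"] by simp
qed

lift_definition scaleR_ell2 :: "real \<Rightarrow> ell2 \<Rightarrow> ell2" is "\<lambda>c a n. of_real c * a n"
  by (simp add: norm_mult power_mult_distrib summable_mult)

definition inner_ell2 :: "ell2 \<Rightarrow> ell2 \<Rightarrow> real" where "inner_ell2 x y = Re (cinner x y)"
definition norm_ell2 :: "ell2 \<Rightarrow> real" where "norm_ell2 x = sqrt (inner x x)"
definition dist_ell2 :: "ell2 \<Rightarrow> ell2 \<Rightarrow> real" where "dist_ell2 x y = norm (x - y)"
definition sgn_ell2 :: "ell2 \<Rightarrow> ell2" where "sgn_ell2 x = inverse (norm x) *\<^sub>R x"
definition uniformity_ell2 :: "(ell2 \<times> ell2) filter" where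
  "uniformity_ell2 = (INF e\<in>{0 <..}. principal {(x, y). dist x y < e})"
definition open_ell2 :: "ell2 set \<Rightarrow> bool" where
  "open_ell2 U = (\<forall>x\<in>U. eventually (\<lambda>(x', y). x' = x \<longrightarrow> y \<in> U) uniformity)"

lemma inner_ell2_self: "inner x x = (\<Sum>n. (cmod (coord x n))\<^sup>2)" for x :: ell2
proof -
  have "cinner x x = (\<Sum>n. of_real ((cmod (coord x n))\<^sup>2))"
    unfolding cinner_def by (intro suminf_cong) (simp add: complex_norm_square del: of_real_power)
  also have "\<dots> = of_real (\<Sum>n. (cmod (coord x n))\<^sup>2)"
    by (rule suminf_of_real[OF summable_coord, symmetric])
  finally show ?thesis by (simp add: inner_ell2_def)
qed

instance
proof
  fix x y z :: ell2 and a b r :: real and U :: "ell2 set"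
  show "x + y + z = x + (y + z)" by transfer (simp add: add.assoc)
  show "x + y = y + x" by transfer (simp add: add.commute)
  show "0 + x = x" by transfer simp
  show "- x + x = 0" by transfer simp
  show "x - y = x + - y" by transfer simp
  show "a *\<^sub>R (x + y) = a *\<^sub>R x + a *\<^sub>R y" by transfer (simp add: algebra_simps)
  show "(a + b) *\<^sub>R x = a *\<^sub>R x + b *\<^sub>R x" by transfer (simp add: algebra_simps)
  show "a *\<^sub>R b *\<^sub>R x = (a * b) *\<^sub>R x" by transfer (simp add: algebra_simps)
  show "1 *\<^sub>R x = x" by transfer simp
  show "dist x y = norm (x - y)" by (rule dist_ell2_def)
  show "sgn x = inverse (norm x) *\<^sub>R x" by (rule sgn_ell2_def)
  show "uniformity = (INF e\<in>{0 <..}. principal {(x :: ell2, y). dist x y < e})"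
    by (rule uniformity_ell2_def)
  show "open U = (\<forall>x\<in>U. \<forall>\<^sub>F (x', y) in uniformity. x' = x \<longrightarrow> y \<in> U)"
    by (rule open_ell2_def)
  show "norm x = sqrt (inner x x)" by (rule norm_ell2_def)
  show "inner x y = inner y x"
  proof -
    have "Re (cinner x y) = (\<Sum>n. Re (coord x n * cnj (coord y n)))" for x y
      unfolding cinner_def by (rule Re_suminf[OF summable_cinner])
    then show ?thesis by (simp add: inner_ell2_def algebra_simps)
  qed
  show "inner (x + y) z = inner x z + inner y z"
    unfolding inner_ell2_def cinner_def plus_ell2.rep_eq distrib_right
    by (subst suminf_add[OF summable_cinner[of x z] summable_cinner[of y z], symmetric]) simp
  show "inner (r *\<^sub>R x) y = r * inner x y"
    unfolding inner_ell2_def cinner_def scaleR_ell2.rep_eq mult.assoc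
    by (subst suminf_mult[OF summable_cinner[of x y]]) simp
  show "0 \<le> inner x x"
    unfolding inner_ell2_self by (intro suminf_nonneg summable_coord) simp
  show "inner x x = 0 \<longleftrightarrow> x = 0"
    unfolding inner_ell2_self
    by (subst suminf_eq_zero_iff[OF summable_coord])
       (auto intro: ell2_eqI simp: zero_ell2.rep_eq)
qed

end

lemmas coord_simps [simp] = zero_ell2.rep_eq plus_ell2.rep_eq uminus_ell2.rep_eq
  minus_ell2.rep_eq cscale.rep_eq

lemma norm_ell2_sq: "(norm x)\<^sup>2 = (\<Sum>n. (cmod (coord x n))\<^sup>2)" for x :: ell2
  by (simp add: dot_square_norm flip: inner_ell2_self)

lemma norm_ell2_eq: "norm x = sqrt (\<Sum>n. (cmod (coord x n))\<^sup>2)" for x :: ell2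
  by (simp flip: norm_ell2_sq)

lemma inner_ell2: "inner x y = Re (cinner x y)"
  by (rule inner_ell2_def)

lemma cinner_add_left: "cinner (x + y) z = cinner x z + cinner y z"
  unfolding cinner_def plus_ell2.rep_eq distrib_right
  by (rule suminf_add[OF summable_cinner[of x z] summable_cinner[of y z], symmetric])

lemma cinner_scale_left [simp]: "cinner (cscale c x) y = c * cinner x y"
  unfolding cinner_def cscale.rep_eq mult.assoc by (rule suminf_mult[OF summable_cinner[of x y]])

lemma cinner_commute: "cinner x y = cnj (cinner y x)"
proof -
  have "(\<lambda>n. coord x n * cnj (coord y n)) sums cnj (cinner y x)"
    using summable_sums[OF summable_cinner[of y x], folded cinner_def]
    by (subst sums_cnj[symmetric]) (simp add: mult.commute)
  then show ?thesis by (simp add: cinner_def sums_iff)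
qed

lemma cinner_self: "cinner x x = of_real ((norm x)\<^sup>2)"
proof -
  have "cnj (cinner x x) = cinner x x" by (metis cinner_commute)
  then have "Im (cinner x x) = 0" by (simp add: complex_eq_iff)
  then show ?thesis by (simp add: complex_eq_iff power2_norm_eq_inner inner_ell2)
qed

lemma cinner_add_right: "cinner z (x + y) = cinner z x + cinner z y"
  by (metis cinner_add_left cinner_commute complex_cnj_add)

lemma cinner_scale_right [simp]: "cinner x (cscale c y) = cnj c * cinner x y"
  by (metis cinner_commute cinner_scale_left complex_cnj_mult)

lemma scaleR_eq_cscale: "r *\<^sub>R x = cscale (of_real r) x"
  by (rule ell2_eqI) (simp add: scaleR_ell2.rep_eq)

lemma cscale_simps [simp]:
  "cscale c 0 = 0" "cscale 0 x = 0" "cscale 1 x = x" "cscale a (cscale b x) = cscale (a * b) x"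
  by (auto intro!: ell2_eqI)

lemma cscale_distribs:
  "cscale c (x + y) = cscale c x + cscale c y" "cscale c (x - y) = cscale c x - cscale c y"
  "cscale (a + b) x = cscale a x + cscale b x" "cscale (a - b) x = cscale a x - cscale b x"
  "cscale c (- x) = - cscale c x" "cscale (- c) x = - cscale c x"
  by (auto intro!: ell2_eqI simp: algebra_simps)

lemma norm_cscale [simp]: "norm (cscale c x) = cmod c * norm x"
proof -
  have "(norm (cscale c x))\<^sup>2 = (cmod c * norm x)\<^sup>2"
    by (simp add: norm_ell2_sq norm_mult power_mult_distrib suminf_mult summable_coord)
  then show ?thesis by (simp add: power2_eq_iff_nonneg)
qed

text \<open>The real Cauchy-Schwarz inequality sees only the real part of \<open>cinner x y\<close>;
  a unimodular factor on \<open>x\<close> first makes the product real and nonnegative.\<close>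

lemma cinner_norm_le: "cmod (cinner x y) \<le> norm x * norm y"
proof -
  obtain u where u: "cmod u = 1" "u * cinner x y = of_real (cmod (cinner x y))"
  proof (cases "cinner x y = 0")
    case True then show ?thesis using that[of 1] by simp
  next
    case False
    have "cnj (cinner x y) * cinner x y = of_real (cmod (cinner x y)) * of_real (cmod (cinner x y))"
      using complex_norm_square[of "cinner x y"] by (simp add: power2_eq_square mult.commute)
    with False show ?thesis
      by (intro that[of "cnj (cinner x y) / cmod (cinner x y)"]) (auto simp: norm_divide)
  qed
  have "cmod (cinner x y) = inner (cscale u x) y" by (simp add: inner_ell2 u)
  also have "\<dots> \<le> norm (cscale u x) * norm y" by (rule norm_cauchy_schwarz)
  finally show ?thesis by (simp add: u)
qed

lemma bounded_linear_cinner_left: "bounded_linear (\<lambda>x. cinner x y)"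
  by (rule bounded_linear_intro[of _ "norm y"])
     (auto simp: cinner_add_left scaleR_eq_cscale cinner_norm_le scaleR_conv_of_real)

lemma bounded_linear_cinner_right: "bounded_linear (cinner x)"
  by (rule bounded_linear_intro[of _ "norm x"])
     (auto simp: cinner_add_right scaleR_eq_cscale scaleR_conv_of_real,
      metis cinner_norm_le mult.commute)

lemma bounded_bilinear_cscale: "bounded_bilinear cscale"
proof (rule bounded_bilinear.intro)
  show "\<exists>K. \<forall>a b. norm (cscale a b) \<le> norm a * norm b * K" by (rule exI[of _ 1]) simp
qed (auto simp: cscale_distribs scaleR_eq_cscale scaleR_conv_of_real mult_ac)

lemmas linear_cscale = bounded_linear.linear[OF bounded_bilinear.bounded_linear_right[OF bounded_bilinear_cscale]]

lemmas cinner_diff_left = linear_diff[OF bounded_linear.linear[OF bounded_linear_cinner_left]]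
  and cinner_diff_right = linear_diff[OF bounded_linear.linear[OF bounded_linear_cinner_right]]
  and cinner_zero_left [simp] = linear_0[OF bounded_linear.linear[OF bounded_linear_cinner_left]]
  and cinner_zero_right [simp] = linear_0[OF bounded_linear.linear[OF bounded_linear_cinner_right]]
  and cinner_sum_left = linear_sum[OF bounded_linear.linear[OF bounded_linear_cinner_left]]
  and cinner_sum_right = linear_sum[OF bounded_linear.linear[OF bounded_linear_cinner_right]]

lemma coord_le_norm: "cmod (coord x n) \<le> norm x"
proof -
  have "(cmod (coord x n))\<^sup>2 \<le> (norm x)\<^sup>2"
    unfolding norm_ell2_sq
    using sum_le_suminf[OF summable_coord[of x], of "{n}"] by simp
  then show ?thesis by (simp add: power2_le_iff_abs_le)
qed

lemma bounded_linear_coord: "bounded_linear (\<lambda>x. coord x n)"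
  by (rule bounded_linear_intro[of _ 1])
     (auto simp: scaleR_ell2.rep_eq scaleR_conv_of_real coord_le_norm)

lemma partial_sum_le_norm: "(\<Sum>n<N. (cmod (coord x n))\<^sup>2) \<le> (norm x)\<^sup>2"
  unfolding norm_ell2_sq by (rule sum_le_suminf[OF summable_coord]) auto

text \<open>The limit is taken coordinate by coordinate. Distances are estimated on the first
  \<open>N\<close> coordinates only, where the limit can be taken inside the sum; the bound does not
  depend on \<open>N\<close>, so it passes to the whole series.\<close>

instance ell2 :: banach
proof
  fix X :: "nat \<Rightarrow> ell2" assume X: "Cauchy X"
  define a where "a k = lim (\<lambda>n. coord (X n) k)" for k
  have a: "(\<lambda>n. coord (X n) k) \<longlonglongrightarrow> a k" for k
    unfolding a_def
    using bounded_linear.Cauchy[OF bounded_linear_coord X] Cauchy_convergent_iff convergent_LIMSEQ_iff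
    by blast
  have tail: "(\<Sum>k<N. (cmod (coord (X n) k - a k))\<^sup>2) \<le> e\<^sup>2"
    if e: "0 < e" and M: "\<And>n m. n \<ge> M \<Longrightarrow> m \<ge> M \<Longrightarrow> norm (X n - X m) < e" and n: "n \<ge> M" for e M n N
  proof (rule LIMSEQ_le_const2)
    show "(\<lambda>m. \<Sum>k<N. (cmod (coord (X n) k - coord (X m) k))\<^sup>2)
        \<longlonglongrightarrow> (\<Sum>k<N. (cmod (coord (X n) k - a k))\<^sup>2)"
      by (intro tendsto_intros a)
    have "(\<Sum>k<N. (cmod (coord (X n) k - coord (X m) k))\<^sup>2) \<le> e\<^sup>2" if "m \<ge> M" for m
    proof -
      have "(\<Sum>k<N. (cmod (coord (X n) k - coord (X m) k))\<^sup>2) \<le> (norm (X n - X m))\<^sup>2"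
        using partial_sum_le_norm[of "X n - X m" N] by simp
      also have "\<dots> \<le> e\<^sup>2" using M[OF n that] by (intro power_mono) auto
      finally show ?thesis .
    qed
    then show "\<exists>M. \<forall>m\<ge>M. (\<Sum>k<N. (cmod (coord (X n) k - coord (X m) k))\<^sup>2) \<le> e\<^sup>2" by blast
  qed
  have ex: "\<exists>M. \<forall>n\<ge>M. \<forall>m\<ge>M. norm (X n - X m) < e" if "e > 0" for e
    using X that unfolding Cauchy_iff by blast
  have diff: "summable (\<lambda>k. (cmod (coord (X n) k - a k))\<^sup>2) \<and> (\<Sum>k. (cmod (coord (X n) k - a k))\<^sup>2) \<le> e\<^sup>2"
    if "0 < e" "\<And>n m. n \<ge> M \<Longrightarrow> m \<ge> M \<Longrightarrow> norm (X n - X m) < e" "n \<ge> M" for e M n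
  proof -
    have b: "(\<Sum>k<N. (cmod (coord (X n) k - a k))\<^sup>2) \<le> e\<^sup>2" for N by (rule tail[OF that])
    then have "summable (\<lambda>k. (cmod (coord (X n) k - a k))\<^sup>2)"
      by (intro summableI_nonneg_bounded) auto
    then show ?thesis using suminf_le_const[OF _ b] by blast
  qed
  obtain M1 where M1: "\<And>n m. n \<ge> M1 \<Longrightarrow> m \<ge> M1 \<Longrightarrow> norm (X n - X m) < 1"
    using ex[of 1] by auto
  have "summable (\<lambda>k. (cmod (a k - coord (X M1) k))\<^sup>2)"
    using diff[OF _ M1, of M1] by (simp add: norm_minus_commute)
  from summable_cmod2_add[OF this summable_coord[of "X M1"]]
  have sa: "summable (\<lambda>k. (cmod (a k))\<^sup>2)" by simp
  define x where "x = Abs_ell2 a"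
  have x: "coord x = a" unfolding x_def by (simp add: Abs_ell2_inverse sa)
  have "X \<longlonglongrightarrow> x"
  proof (rule LIMSEQ_I)
    fix e :: real assume e: "e > 0"
    obtain M where M: "\<And>n m. n \<ge> M \<Longrightarrow> m \<ge> M \<Longrightarrow> norm (X n - X m) < e/2"
      using ex[of "e/2"] e by auto
    have "norm (X n - x) < e" if "n \<ge> M" for n
    proof -
      have "(norm (X n - x))\<^sup>2 \<le> (e/2)\<^sup>2"
        unfolding norm_ell2_sq using diff[OF _ M that] e by (simp add: x)
      then have "norm (X n - x) \<le> e/2" using e by (simp add: power2_le_iff_abs_le)
      then show ?thesis using e by simp
    qed
    then show "\<exists>no. \<forall>n\<ge>no. norm (X n - x) < e" by blast
  qed
  then show "convergent X" by (rule convergentI)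
qed

section \<open>Orthogonality and projections onto closed subspaces\<close>

lemma pythagoras:
  assumes "cinner a b = 0"
  shows "(norm (a + b))\<^sup>2 = (norm a)\<^sup>2 + (norm b)\<^sup>2"
proof -
  have "a \<bullet> b = 0" using assms by (simp add: inner_ell2)
  then show ?thesis
    by (simp only: power2_norm_eq_inner inner_add_left inner_add_right) (simp add: inner_commute)
qed

definition csubspace :: "ell2 set \<Rightarrow> bool" where
  "csubspace N \<longleftrightarrow> 0 \<in> N \<and> (\<forall>x\<in>N. \<forall>y\<in>N. x + y \<in> N) \<and> (\<forall>c. \<forall>x\<in>N. cscale c x \<in> N)"

lemma csubspaceD:
  assumes "csubspace N"
  shows "0 \<in> N" "x \<in> N \<Longrightarrow> y \<in> N \<Longrightarrow> x + y \<in> N" "x \<in> N \<Longrightarrow> cscale c x \<in> N"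
    "x \<in> N \<Longrightarrow> y \<in> N \<Longrightarrow> x - y \<in> N"
proof -
  show "x - y \<in> N" if "x \<in> N" "y \<in> N"
  proof -
    have "x + cscale (- 1) y \<in> N" using assms that unfolding csubspace_def by blast
    then show ?thesis by (simp add: cscale_distribs)
  qed
qed (use assms in \<open>auto simp: csubspace_def\<close>)

text \<open>The projection is the nearest point of \<open>N\<close>. Midpoints of a minimizing
  sequence stay in \<open>N\<close>, so the parallelogram law makes that sequence Cauchy.\<close>

lemma orthogonal_projection_exists:
  assumes "csubspace N" "closed N"
  obtains y where "y \<in> N" "\<And>z. z \<in> N \<Longrightarrow> cinner (x - y) z = 0"
proof -
  note N = csubspaceD[OF assms(1)]
  define d where "d = Inf ((\<lambda>y. (norm (x - y))\<^sup>2) ` N)"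
  have bdd: "bdd_below ((\<lambda>y. (norm (x - y))\<^sup>2) ` N)" by (rule bdd_belowI[of _ 0]) auto
  have d_le: "d \<le> (norm (x - y))\<^sup>2" if "y \<in> N" for y
    unfolding d_def by (rule cInf_lower[OF _ bdd]) (use that in auto)
  have "\<exists>y\<in>N. (norm (x - y))\<^sup>2 < d + 1 / Suc n" for n
    using cInf_lessD[of "(\<lambda>y. (norm (x - y))\<^sup>2) ` N" "d + 1 / Suc n"] N(1)
    by (auto simp: d_def)
  then obtain Y where Y: "\<And>n. Y n \<in> N" "\<And>n. (norm (x - Y n))\<^sup>2 < d + 1 / Suc n" by metis
  have close: "(norm (Y m - Y n))\<^sup>2 \<le> 2 / Suc m + 2 / Suc n" for m n
  proof -
    have "d \<le> (norm (x - cscale (1/2) (Y m + Y n)))\<^sup>2" by (intro d_le N Y)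
    moreover have "x - cscale (1/2) (Y m + Y n) = (1/2) *\<^sub>R ((x - Y m) + (x - Y n))"
      by (auto intro!: ell2_eqI simp: scaleR_ell2.rep_eq field_simps)
    ultimately have "4 * d \<le> (norm ((x - Y m) + (x - Y n)))\<^sup>2"
      by (simp add: power_mult_distrib power_divide)
    moreover have "(norm ((x - Y m) - (x - Y n)))\<^sup>2 + (norm ((x - Y m) + (x - Y n)))\<^sup>2
        = 2 * (norm (x - Y m))\<^sup>2 + 2 * (norm (x - Y n))\<^sup>2"
      by (simp only: power2_norm_eq_inner) (simp add: inner_simps)
    moreover have "(x - Y m) - (x - Y n) = - (Y m - Y n)" by simp
    ultimately show ?thesis using Y(2)[of m] Y(2)[of n] by (simp only: norm_minus_cancel)
  qed
  have "Cauchy Y"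
  proof (rule CauchyI)
    fix e :: real assume e: "e > 0"
    then obtain K where K: "4 / e\<^sup>2 < of_nat (Suc K)"
      using reals_Archimedean2 by (metis less_SucI of_nat_less_iff less_trans lessI)
    have "norm (Y m - Y n) < e" if "m \<ge> K" "n \<ge> K" for m n
    proof -
      have "2 / real (Suc m) + 2 / Suc n \<le> 2 / Suc K + 2 / Suc K"
        using that by (intro add_mono divide_left_mono) auto
      also have "\<dots> = 4 / Suc K" by simp
      also have "\<dots> < e\<^sup>2" using K e by (simp add: field_simps)
      finally have "(norm (Y m - Y n))\<^sup>2 < e\<^sup>2" using close[of m n] by linarith
      then show ?thesis using e by (simp add: power2_less_imp_less)
    qed
    then show "\<exists>M. \<forall>m\<ge>M. \<forall>n\<ge>M. norm (Y m - Y n) < e" by blast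
  qed
  then obtain y where y: "Y \<longlonglongrightarrow> y" using Cauchy_convergent convergent_def by blast
  have yN: "y \<in> N" using closed_sequentially[OF assms(2) _ y] Y by blast
  have "(norm (x - y))\<^sup>2 \<le> d"
  proof (rule LIMSEQ_le[OF _ _ exI[of _ 0]])
    show "(\<lambda>n. (norm (x - Y n))\<^sup>2) \<longlonglongrightarrow> (norm (x - y))\<^sup>2" by (intro tendsto_intros y)
    show "(\<lambda>n. d + 1 / Suc n) \<longlonglongrightarrow> d"
      using tendsto_add[OF tendsto_const LIMSEQ_Suc[OF lim_const_over_n[of 1]], of d] by simp
    show "\<forall>n\<ge>0. (norm (x - Y n))\<^sup>2 \<le> d + 1 / Suc n" using Y(2) less_imp_le by blast
  qed
  then have min: "(norm (x - y))\<^sup>2 \<le> (norm (x - y'))\<^sup>2" if "y' \<in> N" for y'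
    using d_le[OF that] by linarith
  have "cinner (x - y) z = 0" if z: "z \<in> N" for z
  proof (cases "z = 0")
    case False
    \<comment> \<open>Subtracting the component of \<open>x - y\<close> along \<open>z\<close> moves
      \<open>y\<close> within \<open>N\<close> and shortens the distance by exactly
      \<open>norm (cscale c z)\<close> in the sense of Pythagoras, so minimality forces
      \<open>c = 0\<close>.\<close>
    define c where "c = cinner (x - y) z / of_real ((norm z)\<^sup>2)"
    have nz: "(norm z)\<^sup>2 > 0" using False by simp
    have "cinner ((x - y) - cscale c z) z = 0"
      using nz by (simp add: cinner_diff_left[of "x - y"] cinner_self c_def)
    then have "(norm (x - y))\<^sup>2 = (norm ((x - y) - cscale c z))\<^sup>2 + (norm (cscale c z))\<^sup>2"
      using pythagoras[of "(x - y) - cscale c z" "cscale c z"] by simp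
    moreover have "(norm (x - y))\<^sup>2 \<le> (norm ((x - y) - cscale c z))\<^sup>2"
      using min[OF N(2)[OF yN N(3)[OF z]], of c] by (simp add: algebra_simps)
    ultimately have "norm (cscale c z) = 0" by (smt (verit) zero_le_power2 power2_eq_iff zero_eq_power2)
    then have "c = 0" using False by simp
    then show ?thesis using nz by (simp add: c_def)
  qed simp
  then show ?thesis using that yN by blast
qed

section \<open>The backward shift on sequences and its adjoint\<close>

lift_definition bwd :: "ell2 \<Rightarrow> ell2" is "\<lambda>a n. a (Suc n)"
  by (subst summable_Suc_iff)

lift_definition fwd :: "ell2 \<Rightarrow> ell2" is "\<lambda>a n. case n of 0 \<Rightarrow> 0 | Suc k \<Rightarrow> a k"
  by (subst summable_Suc_iff[symmetric]) simp

lemmas shift_coord [simp] = bwd.rep_eq fwd.rep_eq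

lemma cinner_bwd: "cinner (bwd x) y = cinner x (fwd y)"
  using suminf_split_head[OF summable_cinner[of x "fwd y"]] by (simp add: cinner_def)

lemma norm_bwd: "(norm x)\<^sup>2 = (cmod (coord x 0))\<^sup>2 + (norm (bwd x))\<^sup>2"
  using suminf_split_head[OF summable_coord[of x]] by (simp add: norm_ell2_sq)

lemma norm_bwd_le: "norm (bwd x) \<le> norm x"
proof -
  have "(norm (bwd x))\<^sup>2 \<le> (norm x)\<^sup>2" by (simp add: norm_bwd[of x])
  then show ?thesis by (simp add: power2_le_iff_abs_le)
qed

lemma bounded_linear_bwd: "bounded_linear bwd"
  by (rule bounded_linear_intro[of _ 1])
     (auto intro!: ell2_eqI simp: scaleR_ell2.rep_eq norm_bwd_le)

lemma bwd_cscale: "bwd (cscale c x) = cscale c (bwd x)"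
  by (auto intro!: ell2_eqI)

lemma coord_bwd_funpow: "coord ((bwd ^^ n) x) k = coord x (n + k)"
  by (induction n arbitrary: k) auto

text \<open>The squared norm of the n-th iterate is the n-th tail of a convergent series. All decay
  in the later estimates has its origin here.\<close>

lemma bwd_funpow_tendsto_0: "(\<lambda>n. (bwd ^^ n) x) \<longlonglongrightarrow> 0"
proof -
  have "(\<lambda>n. \<Sum>k. (cmod (coord x (k + n)))\<^sup>2) \<longlonglongrightarrow> 0"
    by (rule suminf_exist_split2[OF summable_coord])
  then have "(\<lambda>n. sqrt (\<Sum>k. (cmod (coord x (k + n)))\<^sup>2)) \<longlonglongrightarrow> sqrt 0"
    by (rule tendsto_real_sqrt)
  then show ?thesis
    by (subst tendsto_norm_zero_iff[symmetric]) (simp add: norm_ell2_eq coord_bwd_funpow add.commute)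
qed

section \<open>Finite rank perturbations of the backward shift\<close>

definition pseries :: "(nat \<Rightarrow> ell2) \<Rightarrow> complex \<Rightarrow> ell2" where
  "pseries x w = (\<Sum>n. cscale (w ^ n) (x n))"

lemma summable_pseries:
  assumes "\<And>n. norm (x n) \<le> B" "cmod w < 1"
  shows "summable (\<lambda>n. cscale (w ^ n) (x n))"
proof (rule summable_comparison_test'[where N = 0])
  show "summable (\<lambda>n. cmod w ^ n * B)"
    using assms(2) by (intro summable_mult2 summable_geometric) simp
  show "norm (cscale (w ^ n) (x n)) \<le> cmod w ^ n * B" for n
    using assms(1) by (simp add: norm_power mult_left_mono)
qed

lemma pseries_sums:
  assumes "\<And>n. norm (x n) \<le> B" "cmod w < 1"
  shows "(\<lambda>n. cscale (w ^ n) (x n)) sums pseries x w"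
  unfolding pseries_def using summable_pseries[of x B w] assms by (simp add: summable_sums)

text \<open>The integrand is the real part of a constant times exp(i k t) with k = n - m a nonzero
  integer, so it has an explicit antiderivative of period 2 pi. The real part and the factor
  \<open>c\<close> are there because this is the shape of the cross terms in the square of a
  norm.\<close>

lemma has_integral_circle_orthogonal:
  assumes "n \<noteq> m"
  shows "((\<lambda>t. Re ((of_real r * cis t) ^ n * cnj ((of_real r * cis t) ^ m) * c)) has_integral 0) {0..2 * pi}"
proof -
  define k :: real where "k = real n - real m"
  have k: "k \<noteq> 0" using assms by (simp add: k_def)
  define G where "G z = of_real (r ^ (n + m)) * c * exp (\<i> * of_real k * z) / (\<i> * of_real k)" for z
  define F where "F t = Re (G (of_real t))" for t :: real
  have eq: "(of_real r * cis t) ^ n * cnj ((of_real r * cis t) ^ m) = of_real (r ^ (n + m)) * cis (k * t)" for t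
    by (simp add: power_mult_distrib Complex.DeMoivre power_add cis_cnj cis_mult k_def algebra_simps
        cis_divide[symmetric])
  have "(F has_vector_derivative Re ((of_real r * cis t) ^ n * cnj ((of_real r * cis t) ^ m) * c))
      (at t within {0..2 * pi})" for t
  proof -
    have "(G has_field_derivative of_real (r ^ (n + m)) * c * exp (\<i> * of_real k * of_real t)) (at (of_real t))"
      unfolding G_def using k by (auto intro!: derivative_eq_intros)
    from bounded_linear.has_vector_derivative[OF bounded_linear_Re has_vector_derivative_real_field[OF this]]
    show ?thesis unfolding F_def eq by (simp add: cis_conv_exp mult_ac)
  qed
  then have "((\<lambda>t. Re ((of_real r * cis t) ^ n * cnj ((of_real r * cis t) ^ m) * c)) has_integral
      (F (2 * pi) - F 0)) {0..2 * pi}"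
    by (intro fundamental_theorem_of_calculus) auto
  moreover have "cis (k * (2 * pi)) = 1"
    using cis_multiple_2pi[of k] by (simp add: k_def mult_ac)
  then have "F (2 * pi) = F 0" by (simp add: F_def G_def cis_conv_exp mult_ac)
  ultimately show ?thesis by simp
qed

lemma has_integral_norm_partial_pseries:
  "((\<lambda>t. (norm (\<Sum>n<N. cscale ((of_real r * cis t) ^ n) (x n)))\<^sup>2) has_integral
     2 * pi * (\<Sum>n<N. (r\<^sup>2) ^ n * (norm (x n))\<^sup>2)) {0..2 * pi}"
proof (induction N)
  case 0
  then show ?case by simp
next
  case (Suc N)
  define w where "w t = of_real r * cis t" for t
  have "(norm (\<Sum>n<Suc N. cscale (w t ^ n) (x n)))\<^sup>2 =
      (norm (\<Sum>n<N. cscale (w t ^ n) (x n)))\<^sup>2 +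
      2 * (\<Sum>n<N. Re (w t ^ n * cnj (w t ^ N) * cinner (x n) (x N))) + (r\<^sup>2) ^ N * (norm (x N))\<^sup>2" for t
  proof -
    have "(norm (cscale (w t ^ N) (x N)))\<^sup>2 = (r\<^sup>2) ^ N * (norm (x N))\<^sup>2"
      using power_mult[of "\<bar>r\<bar>" N 2] power_mult[of "\<bar>r\<bar>" 2 N]
      by (simp add: w_def norm_mult norm_power power_mult_distrib mult.commute)
    moreover have "(\<Sum>n<N. cscale (w t ^ n) (x n)) \<bullet> cscale (w t ^ N) (x N) =
        (\<Sum>n<N. Re (w t ^ n * cnj (w t ^ N) * cinner (x n) (x N)))"
      unfolding inner_ell2 cinner_sum_left Re_sum by (simp only: cinner_scale_left cinner_scale_right complex_cnj_power mult_ac)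
    moreover have "(norm (a + b))\<^sup>2 = (norm a)\<^sup>2 + 2 * (a \<bullet> b) + (norm b)\<^sup>2" for a b :: ell2
      by (simp add: power2_norm_eq_inner inner_add_left inner_add_right inner_commute)
    ultimately show ?thesis by (simp only: sum.lessThan_Suc)
  qed
  moreover have "((\<lambda>t. (norm (\<Sum>n<N. cscale (w t ^ n) (x n)))\<^sup>2 +
      2 * (\<Sum>n<N. Re (w t ^ n * cnj (w t ^ N) * cinner (x n) (x N))) + (r\<^sup>2) ^ N * (norm (x N))\<^sup>2)
      has_integral (2 * pi * (\<Sum>n<N. (r\<^sup>2) ^ n * (norm (x n))\<^sup>2) + 2 * (\<Sum>n<N. 0) +
        2 * pi * ((r\<^sup>2) ^ N * (norm (x N))\<^sup>2))) {0..2 * pi}"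
    unfolding w_def
    using has_integral_const_real[of "(r\<^sup>2) ^ N * (norm (x N))\<^sup>2" 0 "2 * pi"]
    by (intro has_integral_add has_integral_mult_right has_integral_sum Suc.IH
          has_integral_circle_orthogonal) auto
  ultimately show ?case by (simp add: w_def algebra_simps)
qed

lemma parseval:
  assumes B: "\<And>n. norm (x n) \<le> B" and r: "0 \<le> r" "r < 1"
  shows "((\<lambda>t. (norm (pseries x (of_real r * cis t)))\<^sup>2) has_integral
     2 * pi * (\<Sum>n. (r\<^sup>2) ^ n * (norm (x n))\<^sup>2)) {0..2 * pi}"
proof (rule has_integral_dominated_convergence)
  show "((\<lambda>t. (norm (\<Sum>n<N. cscale ((of_real r * cis t) ^ n) (x n)))\<^sup>2) has_integral
     2 * pi * (\<Sum>n<N. (r\<^sup>2) ^ n * (norm (x n))\<^sup>2)) {0..2 * pi}" for N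
    by (rule has_integral_norm_partial_pseries)
  \<comment> \<open>The dominating function is a constant: since \<open>r < 1\<close>, one geometric
    series bounds all partial sums on the whole circle.\<close>
  show "(\<lambda>t :: real. ((\<Sum>n. r ^ n * B))\<^sup>2) integrable_on {0..2 * pi}" by (rule integrable_const_ivl)
  have sm: "summable (\<lambda>n. r ^ n * B)" using r by (intro summable_mult2 summable_geometric) simp
  have B0: "B \<ge> 0" using B[of 0] norm_ge_zero order_trans by blast
  have "norm (\<Sum>n<N. cscale ((of_real r * cis t) ^ n) (x n)) \<le> (\<Sum>n. r ^ n * B)" for N t
  proof -
    have "norm (\<Sum>n<N. cscale ((of_real r * cis t) ^ n) (x n)) \<le> (\<Sum>n<N. r ^ n * B)"
      using B r by (intro sum_norm_le) (simp add: norm_power norm_mult mult_left_mono)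
    also have "\<dots> \<le> (\<Sum>n. r ^ n * B)" using r B0 by (intro sum_le_suminf sm) auto
    finally show ?thesis .
  qed
  then show "\<forall>t\<in>{0..2 * pi}. norm ((norm (\<Sum>n<N. cscale ((of_real r * cis t) ^ n) (x n)))\<^sup>2) \<le> ((\<Sum>n. r ^ n * B))\<^sup>2" for N
    by (auto intro!: power_mono)
  have "(\<lambda>N. \<Sum>n<N. cscale ((of_real r * cis t) ^ n) (x n)) \<longlonglongrightarrow> pseries x (of_real r * cis t)" for t
    using pseries_sums[OF B, of "of_real r * cis t"] r by (simp add: norm_mult sums_def)
  then show "\<forall>t\<in>{0..2 * pi}. (\<lambda>N. (norm (\<Sum>n<N. cscale ((of_real r * cis t) ^ n) (x n)))\<^sup>2)
      \<longlonglongrightarrow> (norm (pseries x (of_real r * cis t)))\<^sup>2"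
    by (intro ballI tendsto_intros)
  have "summable (\<lambda>n. (r\<^sup>2) ^ n * (norm (x n))\<^sup>2)"
  proof (rule summable_comparison_test'[where N = 0])
    show "summable (\<lambda>n. (r\<^sup>2) ^ n * B\<^sup>2)" 
      using r by (intro summable_mult2 summable_geometric) (simp add: abs_square_less_1)
    show "norm ((r\<^sup>2) ^ n * (norm (x n))\<^sup>2) \<le> (r\<^sup>2) ^ n * B\<^sup>2" for n
      using B by (simp add: mult_left_mono power_mono)
  qed
  then show "(\<lambda>N. 2 * pi * (\<Sum>n<N. (r\<^sup>2) ^ n * (norm (x n))\<^sup>2)) \<longlonglongrightarrow> 2 * pi * (\<Sum>n. (r\<^sup>2) ^ n * (norm (x n))\<^sup>2)"
    by (intro tendsto_intros summable_LIMSEQ)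
qed

text \<open>The constant function 1. It embeds scalar series into vector series in
  \<open>parseval_scalar\<close>, and later represents evaluation at 0 as an inner product.\<close>

lift_definition unit0 :: ell2 is "\<lambda>n. if n = 0 then 1 else 0"
  by (rule summable_finite[of "{0}"]) auto

lemma norm_unit0 [simp]: "norm unit0 = 1"
proof -
  have "(\<lambda>n. (cmod (coord unit0 n))\<^sup>2) = (\<lambda>n. if n = 0 then 1 else 0)"
    by (auto simp: unit0.rep_eq)
  then show ?thesis
    using sums_unique[OF sums_single[of 0 "\<lambda>_. 1 :: real"]] by (simp add: norm_ell2_eq)
qed

lemma parseval_scalar:
  fixes a :: "nat \<Rightarrow> complex"
  assumes B: "\<And>n. cmod (a n) \<le> B" and r: "0 \<le> r" "r < 1"
  shows "((\<lambda>t. (cmod (\<Sum>n. (of_real r * cis t) ^ n * a n))\<^sup>2) has_integral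
     2 * pi * (\<Sum>n. (r\<^sup>2) ^ n * (cmod (a n))\<^sup>2)) {0..2 * pi}"
proof -
  have nb: "norm (cscale (a n) unit0) \<le> B" for n using B by simp
  have "norm (pseries (\<lambda>n. cscale (a n) unit0) w) = cmod (\<Sum>n. w ^ n * a n)" if w: "cmod w < 1" for w
  proof -
    have "summable (\<lambda>n. cmod (w ^ n * a n))"
    proof (rule summable_comparison_test'[where N = 0])
      show "summable (\<lambda>n. cmod w ^ n * B)" using w by (intro summable_mult2 summable_geometric) simp
      show "norm (cmod (w ^ n * a n)) \<le> cmod w ^ n * B" for n
        using B by (simp add: norm_mult norm_power mult_left_mono)
    qed
    then have "summable (\<lambda>n. w ^ n * a n)" by (rule summable_norm_cancel)
    from bounded_linear.suminf[OF bounded_bilinear.bounded_linear_left[OF bounded_bilinear_cscale] this, of unit0]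
    have "pseries (\<lambda>n. cscale (a n) unit0) w = cscale (\<Sum>n. w ^ n * a n) unit0"
      by (simp add: pseries_def)
    then show ?thesis by simp
  qed
  from this[of "of_real r * cis _"] r parseval[of "\<lambda>n. cscale (a n) unit0" B r, OF nb r] show ?thesis by (simp add: norm_mult)
qed

text \<open>The weights (1 - t) t^n have sum 1, and each of them tends to 0 as t tends to 1. So the
  first \<open>N\<close> terms disappear in the limit, and the others are averages of numbers below
  e / 2.\<close>

lemma abel_mean_tendsto_0:
  fixes b :: "nat \<Rightarrow> real"
  assumes b: "b \<longlonglongrightarrow> 0"
  shows "((\<lambda>t. (1 - t) * (\<Sum>n. t ^ n * b n)) \<longlongrightarrow> 0) (at_left 1)"
proof (rule tendstoI)
  fix e :: real assume e: "e > 0"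
  obtain N where N: "\<And>n. n \<ge> N \<Longrightarrow> \<bar>b n\<bar> < e / 2"
    using LIMSEQ_D[OF b, of "e / 2"] e by auto
  define K where "K = (\<Sum>n<N. \<bar>b n\<bar>)"
  have K: "K \<ge> 0" unfolding K_def by (intro sum_nonneg) auto
  have bound: "\<bar>(1 - t) * (\<Sum>n. t ^ n * b n)\<bar> \<le> (1 - t) * K + e / 2" if t: "0 < t" "t < 1" for t
  proof -
    let ?c = "\<lambda>n. (if n < N then \<bar>b n\<bar> else 0) + t ^ n * (e / 2)"
    have geo: "(\<lambda>n. t ^ n * (e / 2)) sums (1 / (1 - t) * (e / 2))"
      using t by (intro sums_mult2 geometric_sums) auto
    have "(\<lambda>n. if n < N then \<bar>b n\<bar> else 0) sums K"
      using sums_If_finite_set[of "{..<N}" "\<lambda>n. \<bar>b n\<bar>"] by (simp add: K_def)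
    from sums_add[OF this geo] have c: "?c sums (K + 1 / (1 - t) * (e / 2))" .
    have le: "norm (t ^ n * b n) \<le> ?c n" for n
    proof (cases "n < N")
      case True
      have "t ^ n * \<bar>b n\<bar> \<le> 1 * \<bar>b n\<bar>" using t by (intro mult_right_mono power_le_one) auto
      then show ?thesis using True t e by (simp add: abs_mult) (smt (verit) divide_pos_pos mult_pos_pos zero_less_power)
    next
      case False
      then show ?thesis using N[of n] t by (simp add: abs_mult mult_left_mono)
    qed
    have sm: "summable (\<lambda>n. norm (t ^ n * b n))"
      by (rule summable_comparison_test'[OF sums_summable[OF c], of 0]) (use le in simp)
    have "norm (\<Sum>n. t ^ n * b n) \<le> (\<Sum>n. norm (t ^ n * b n))" by (rule summable_norm[OF sm])
    also have "\<dots> \<le> (\<Sum>n. ?c n)" by (rule suminf_le[OF le sm sums_summable[OF c]])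
    finally have "\<bar>\<Sum>n. t ^ n * b n\<bar> \<le> K + 1 / (1 - t) * (e / 2)"
      using sums_unique[OF c] by simp
    then have "(1 - t) * \<bar>\<Sum>n. t ^ n * b n\<bar> \<le> (1 - t) * (K + 1 / (1 - t) * (e / 2))"
      using t by (intro mult_left_mono) auto
    also have "\<dots> = (1 - t) * K + e / 2" using t by (simp add: field_simps)
    finally show ?thesis using t by (simp add: abs_mult)
  qed
  \<comment> \<open>This threshold gives (1 - t) K < e / 2. The 1 added to \<open>K\<close> allows
    for \<open>K = 0\<close>, and the maximum with 0 secures the positivity of \<open>t\<close> that
    \<open>bound\<close> asks for.\<close>
  have "\<forall>\<^sub>F t in at_left 1. max 0 (1 - e / (2 * (K + 1))) < t"
    using e K by (intro eventually_at_leftI[of "max 0 (1 - e / (2 * (K + 1)))"]) auto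
  moreover have "\<forall>\<^sub>F t in at_left (1 :: real). t < 1"
    by (auto simp: eventually_at_filter)
  ultimately show "\<forall>\<^sub>F t in at_left 1. dist ((1 - t) * (\<Sum>n. t ^ n * b n)) 0 < e"
  proof eventually_elim
    case (elim t)
    have "(1 - t) * K \<le> (1 - t) * (K + 1)" using elim by (intro mult_left_mono) auto
    also have "\<dots> < e / (2 * (K + 1)) * (K + 1)" using elim K by (intro mult_strict_right_mono) auto
    also have "\<dots> = e / 2" using K by (simp add: field_simps)
    finally show ?case using bound[of t] elim by simp
  qed
qed

text \<open>The coupling lies in the repetition of \<open>d\<close>: a vector whose norm
  \<open>T\<close> preserves is orthogonal to every \<open>d j\<close>, and on such a vector
  \<open>T\<close> agrees with \<open>bwd\<close>.\<close>

locale shift_perturbation =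
  fixes T :: "ell2 \<Rightarrow> ell2" and I :: "'i set" and d v :: "'i \<Rightarrow> ell2"
  assumes finite_I: "finite I"
    and T_eq: "T x = bwd x - (\<Sum>j\<in>I. cscale (cinner x (d j)) (v j))"
    and energy: "(norm x)\<^sup>2 = (norm (T x))\<^sup>2 + (\<Sum>j\<in>I. (cmod (cinner x (d j)))\<^sup>2)"
begin

lemma norm_T_le: "norm (T x) \<le> norm x"
proof -
  have "(norm (T x))\<^sup>2 \<le> (norm x)\<^sup>2" by (simp add: energy[of x] sum_nonneg)
  then show ?thesis by (simp add: power2_le_iff_abs_le)
qed

lemma bounded_linear_T: "bounded_linear T"
proof (rule bounded_linear_intro[of _ 1])
  show "T (x + y) = T x + T y" for x y
    by (simp add: T_eq cinner_add_left cscale_distribs sum.distrib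
        linear_add[OF bounded_linear.linear[OF bounded_linear_bwd]])
  show "T (r *\<^sub>R x) = r *\<^sub>R T x" for r x
    by (simp add: T_eq scaleR_eq_cscale bwd_cscale cscale_distribs
        linear_sum[OF linear_cscale])
qed (simp add: norm_T_le)

lemma T_cscale: "T (cscale c x) = cscale c (T x)"
  by (simp add: T_eq bwd_cscale cscale_distribs
        linear_sum[OF linear_cscale])

lemma funpow_T_linear:
  "(T ^^ n) (x + y) = (T ^^ n) x + (T ^^ n) y"
  "(T ^^ n) (x - y) = (T ^^ n) x - (T ^^ n) y"
  "(T ^^ n) (cscale c x) = cscale c ((T ^^ n) x)"
  "(T ^^ n) 0 = 0"
  using linear_add[OF bounded_linear.linear[OF bounded_linear_T]]
    linear_diff[OF bounded_linear.linear[OF bounded_linear_T]]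
    linear_0[OF bounded_linear.linear[OF bounded_linear_T]] T_cscale
  by (induction n) auto

lemma energy_funpow:
  "(norm x)\<^sup>2 = (norm ((T ^^ n) x))\<^sup>2 + (\<Sum>k<n. \<Sum>j\<in>I. (cmod (cinner ((T ^^ k) x) (d j)))\<^sup>2)"
proof (induction n)
  case (Suc n)
  then show ?case using energy[of "(T ^^ n) x"] by simp
qed simp

lemma norm_funpow_T_decreasing: "m \<le> n \<Longrightarrow> norm ((T ^^ n) x) \<le> norm ((T ^^ m) x)"
  by (induction n rule: dec_induct) (auto intro: order_trans[OF norm_T_le])

lemma norm_funpow_T_le: "norm ((T ^^ n) x) \<le> norm x"
  using norm_funpow_T_decreasing[of 0 n x] by simp

lemma energy_sum_le: "(\<Sum>j\<in>I. \<Sum>k<n. (cmod (cinner ((T ^^ k) x) (d j)))\<^sup>2) \<le> (norm x)\<^sup>2"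
  by (subst sum.swap) (simp add: energy_funpow[of x n])

lemma summable_energy:
  assumes j: "j \<in> I"
  shows "summable (\<lambda>n. (cmod (cinner ((T ^^ n) x) (d j)))\<^sup>2)"
proof (rule summableI_nonneg_bounded)
  fix n
  have "(\<Sum>k<n. (cmod (cinner ((T ^^ k) x) (d j)))\<^sup>2) \<le> (\<Sum>j\<in>I. \<Sum>k<n. (cmod (cinner ((T ^^ k) x) (d j)))\<^sup>2)"
    using j finite_I by (intro member_le_sum sum_nonneg) auto
  also have "\<dots> \<le> (norm x)\<^sup>2" by (rule energy_sum_le)
  finally show "(\<Sum>k<n. (cmod (cinner ((T ^^ k) x) (d j)))\<^sup>2) \<le> (norm x)\<^sup>2" .
qed simp

lemma energy_suminf_le: "(\<Sum>j\<in>I. \<Sum>n. (cmod (cinner ((T ^^ n) x) (d j)))\<^sup>2) \<le> (norm x)\<^sup>2"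
proof (rule LIMSEQ_le_const2)
  show "(\<lambda>n. \<Sum>j\<in>I. \<Sum>k<n. (cmod (cinner ((T ^^ k) x) (d j)))\<^sup>2)
      \<longlonglongrightarrow> (\<Sum>j\<in>I. \<Sum>n. (cmod (cinner ((T ^^ n) x) (d j)))\<^sup>2)"
    by (intro tendsto_sum summable_LIMSEQ summable_energy)
qed (use energy_sum_le in blast)

text \<open>This is (1 - w \<open>T\<close>)^{-1} f, given by its Neumann series;
  \<open>shift_resolvent\<close> is the same for \<open>bwd\<close>.\<close>

definition resolvent :: "ell2 \<Rightarrow> complex \<Rightarrow> ell2" where
  "resolvent f w = pseries (\<lambda>n. (T ^^ n) f) w"

definition shift_resolvent :: "ell2 \<Rightarrow> complex \<Rightarrow> ell2" where
  "shift_resolvent f w = pseries (\<lambda>n. (bwd ^^ n) f) w"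

lemma norm_funpow_bwd_le: "norm ((bwd ^^ n) x) \<le> norm x"
  by (induction n) (auto intro: order_trans[OF norm_bwd_le])

lemma pseries_funpow_eq:
  assumes L: "bounded_linear L" "\<And>c x. L (cscale c x) = cscale c (L x)"
    and le: "\<And>n. norm ((L ^^ n) f) \<le> norm f" and w: "cmod w < 1"
  shows "pseries (\<lambda>n. (L ^^ n) f) w = f + cscale w (L (pseries (\<lambda>n. (L ^^ n) f) w))"
proof -
  have s: "(\<lambda>n. cscale (w ^ n) ((L ^^ n) f)) sums pseries (\<lambda>n. (L ^^ n) f) w"
    using pseries_sums[of "\<lambda>n. (L ^^ n) f" "norm f", OF le w] .
  have "(\<lambda>n. cscale w (L (cscale (w ^ n) ((L ^^ n) f)))) sums cscale w (L (pseries (\<lambda>n. (L ^^ n) f) w))"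
    by (intro bounded_linear.sums[OF bounded_bilinear.bounded_linear_right[OF bounded_bilinear_cscale]]
          bounded_linear.sums[OF L(1)] s)
  then have "(\<lambda>n. cscale (w ^ Suc n) ((L ^^ Suc n) f)) sums cscale w (L (pseries (\<lambda>n. (L ^^ n) f) w))"
    by (simp add: L(2))
  from sums_Suc[OF this] show ?thesis using s by (auto simp: add.commute dest: sums_unique2)
qed

lemma resolvent_eq:
  assumes "cmod w < 1"
  shows "resolvent f w = f + cscale w (T (resolvent f w))"
  unfolding resolvent_def
  by (rule pseries_funpow_eq[OF bounded_linear_T T_cscale norm_funpow_T_le assms])

lemma shift_resolvent_eq:
  assumes "cmod w < 1"
  shows "shift_resolvent f w = f + cscale w (bwd (shift_resolvent f w))"
  unfolding shift_resolvent_def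
  by (rule pseries_funpow_eq[OF bounded_linear_bwd bwd_cscale norm_funpow_bwd_le assms])

lemma cinner_resolvent:
  assumes "cmod w < 1"
  shows "cinner (resolvent f w) y = (\<Sum>n. w ^ n * cinner ((T ^^ n) f) y)"
  using bounded_linear.sums[OF bounded_linear_cinner_left pseries_sums[of "\<lambda>n. (T ^^ n) f" "norm f", OF norm_funpow_T_le assms], of y]
  by (simp add: resolvent_def sums_iff)

text \<open>With the numbers \<open>?k j\<close> held fixed, both sides solve the same equation x =
  f + w \<open>bwd\<close> x - (sum of w \<open>?k j\<close> \<open>v j\<close>). Their difference
  \<open>D\<close> satisfies D = w \<open>bwd\<close> D, and \<open>bwd\<close> is a contraction
  while |w| < 1, so it is 0.\<close>

lemma resolvent_eq_shift_resolvent: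
  assumes w: "cmod w < 1"
  shows "resolvent f w = shift_resolvent f w -
    (\<Sum>j\<in>I. cscale (w * cinner (resolvent f w) (d j)) (shift_resolvent (v j) w))" (is "_ = ?R")
proof -
  let ?k = "\<lambda>j. cinner (resolvent f w) (d j)"
  note lin = bounded_linear.linear[OF bounded_linear_bwd]
  note clin = linear_sum[OF linear_cscale]
  have h: "resolvent f w = f + cscale w (bwd (resolvent f w)) - (\<Sum>j\<in>I. cscale (w * ?k j) (v j))"
    by (subst (1) resolvent_eq[OF w]) (simp add: T_eq cscale_distribs clin)
  have "(\<Sum>j\<in>I. cscale (w * ?k j) (shift_resolvent (v j) w)) =
      (\<Sum>j\<in>I. cscale (w * ?k j) (v j + cscale w (bwd (shift_resolvent (v j) w))))"
    using shift_resolvent_eq[OF w] by simp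
  also have "\<dots> = (\<Sum>j\<in>I. cscale (w * ?k j) (v j)) +
      cscale w (bwd (\<Sum>j\<in>I. cscale (w * ?k j) (shift_resolvent (v j) w)))"
    by (simp add: cscale_distribs sum.distrib linear_sum[OF lin] clin bwd_cscale mult_ac)
  finally have S: "(\<Sum>j\<in>I. cscale (w * ?k j) (shift_resolvent (v j) w)) = \<dots>" .
  have R: "?R = f + cscale w (bwd ?R) - (\<Sum>j\<in>I. cscale (w * ?k j) (v j))"
    by (subst S, subst shift_resolvent_eq[OF w])
       (simp add: linear_diff[OF lin] cscale_distribs)
  define D where "D = resolvent f w - ?R"
  have "D = cscale w (bwd D)"
    unfolding D_def by (subst h, subst R) (simp add: linear_diff[OF lin] cscale_distribs)
  then have "norm D = cmod w * norm (bwd D)" by (metis norm_cscale)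
  also have "\<dots> \<le> cmod w * norm D" by (intro mult_left_mono norm_bwd_le) simp
  finally have "(1 - cmod w) * norm D \<le> 0" by (simp add: algebra_simps)
  then have "norm D \<le> 0" using w by (simp add: mult_le_0_iff)
  then show ?thesis by (simp add: D_def)
qed

text \<open>For h = \<open>resolvent f w\<close> one has h - f = w \<open>T\<close> h, so |h - f| is
  at most |w| |h|. Expanding |h - f|^2 and dropping |f|^2 gives the claim.\<close>

lemma norm_resolvent_le_cinner:
  assumes w: "cmod w < 1"
  shows "(1 - (cmod w)\<^sup>2) * (norm (resolvent f w))\<^sup>2 \<le> 2 * cmod (cinner (resolvent f w) f)"
proof -
  let ?h = "resolvent f w"
  have "cscale w (T ?h) = ?h - f" using resolvent_eq[OF w, of f] by (metis add_diff_cancel_left')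
  then have "(cmod w)\<^sup>2 * (norm (T ?h))\<^sup>2 = (norm (?h - f))\<^sup>2"
    by (metis norm_cscale power_mult_distrib)
  also have "\<dots> = (norm ?h)\<^sup>2 - 2 * Re (cinner ?h f) + (norm f)\<^sup>2"
    by (simp only: power2_norm_eq_inner) (simp add: inner_diff_left inner_diff_right inner_commute inner_ell2[of ?h f, symmetric])
  finally have "(norm ?h)\<^sup>2 - 2 * Re (cinner ?h f) \<le> (cmod w)\<^sup>2 * (norm (T ?h))\<^sup>2" by simp
  also have "\<dots> \<le> (cmod w)\<^sup>2 * (norm ?h)\<^sup>2" by (intro mult_left_mono power_mono norm_T_le) auto
  finally show ?thesis using complex_Re_le_cmod[of "cinner ?h f"] by (simp add: algebra_simps)
qed

text \<open>The passage from the mean of a square root to the mean itself is done pointwise, with a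
  free cutoff \<open>s\<close>, so that only squares have to be integrated. Let J be the left side
  and h the resolvent. If J <= s^2, then J is at most s times its square root, which the comparison
  with the shift resolvents controls. Otherwise s^2 J <= J^2, and J^2 is at most 4 |<h, f>|^2 by
  \<open>norm_resolvent_le_cinner\<close>.\<close>

lemma norm_resolvent_le_energy:
  assumes w: "cmod w < 1" and s: "0 < s"
  shows "(1 - (cmod w)\<^sup>2) * (norm (resolvent f w))\<^sup>2 \<le>
    1 / s + s ^ 3 / 4 * (1 - (cmod w)\<^sup>2) * (norm (shift_resolvent f w))\<^sup>2
    + (\<Sum>j\<in>I. (cmod (cinner (resolvent f w) (d j)))\<^sup>2 / s
         + s ^ 3 / 4 * (1 - (cmod w)\<^sup>2) * (norm (shift_resolvent (v j) w))\<^sup>2)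
    + 4 / s\<^sup>2 * (cmod (cinner (resolvent f w) f))\<^sup>2"
proof -
  let ?h = "resolvent f w" and ?k = "\<lambda>j. cinner (resolvent f w) (d j)"
  define \<delta> where "\<delta> = sqrt (1 - (cmod w)\<^sup>2)"
  have pos: "1 - (cmod w)\<^sup>2 > 0" using w by (simp add: abs_square_less_1)
  then have \<delta>: "\<delta> \<ge> 0" "\<delta>\<^sup>2 = 1 - (cmod w)\<^sup>2" by (auto simp: \<delta>_def)
  define J where "J = (\<delta> * norm ?h)\<^sup>2"
  \<comment> \<open>The weights put a small factor 1 / s on \<open>a\<close>, whose mean square is
    merely bounded, and the large factor s^3 / 4 on the shift resolvents, whose contribution
    vanishes as |w| tends to 1 for fixed \<open>s\<close>.\<close>
  have young: "s * (a * (\<delta> * b)) \<le> a\<^sup>2 / s + s ^ 3 / 4 * (1 - (cmod w)\<^sup>2) * b\<^sup>2" for a b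
  proof -
    have "0 \<le> (a - s\<^sup>2 * \<delta> * b / 2)\<^sup>2 / s" using s by simp
    also have "\<dots> = a\<^sup>2 / s - s * (a * (\<delta> * b)) + s ^ 3 / 4 * \<delta>\<^sup>2 * b\<^sup>2"
      using s by (simp add: power2_diff power_mult_distrib field_simps eval_nat_numeral)
    finally show ?thesis by (simp add: \<delta>)
  qed
  have "norm ?h \<le> norm (shift_resolvent f w) + (\<Sum>j\<in>I. norm (cscale (w * ?k j) (shift_resolvent (v j) w)))"
    by (subst (1) resolvent_eq_shift_resolvent[OF w])
       (intro order_trans[OF norm_triangle_ineq4] add_left_mono norm_sum)
  also have "\<dots> \<le> norm (shift_resolvent f w) + (\<Sum>j\<in>I. cmod (?k j) * norm (shift_resolvent (v j) w))"
    using w by (intro add_left_mono sum_mono)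
       (auto simp: norm_mult mult.assoc intro!: mult_left_le_one_le)
  finally have "s * (\<delta> * norm ?h) \<le>
      s * (\<delta> * (norm (shift_resolvent f w) + (\<Sum>j\<in>I. cmod (?k j) * norm (shift_resolvent (v j) w))))"
    using \<delta> s by (intro mult_left_mono) auto
  \<comment> \<open>The factor 1 brings the first term into the form to which \<open>young\<close>
    applies.\<close>
  also have "\<dots> = s * (1 * (\<delta> * norm (shift_resolvent f w))) +
      (\<Sum>j\<in>I. s * (cmod (?k j) * (\<delta> * norm (shift_resolvent (v j) w))))"
    by (simp add: algebra_simps sum_distrib_left)
  also have "\<dots> \<le> (1\<^sup>2 / s + s ^ 3 / 4 * (1 - (cmod w)\<^sup>2) * (norm (shift_resolvent f w))\<^sup>2)
    + (\<Sum>j\<in>I. (cmod (?k j))\<^sup>2 / s + s ^ 3 / 4 * (1 - (cmod w)\<^sup>2) * (norm (shift_resolvent (v j) w))\<^sup>2)"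
    by (intro add_mono sum_mono young)
  finally have 1: "s * (\<delta> * norm ?h) \<le> \<dots>" .
  have J: "J \<le> 2 * cmod (cinner ?h f)"
    using norm_resolvent_le_cinner[OF w, of f] by (simp add: J_def power_mult_distrib \<delta>)
  have "J \<le> s * (\<delta> * norm ?h) + 4 / s\<^sup>2 * (cmod (cinner ?h f))\<^sup>2"
  proof (cases "\<delta> * norm ?h \<le> s")
    case True
    then have "J \<le> s * (\<delta> * norm ?h)"
      unfolding J_def power2_eq_square using \<delta> by (intro mult_right_mono) auto
    then show ?thesis using s by (simp add: add_increasing2)
  next
    case False
    then have "s\<^sup>2 \<le> J" unfolding J_def using s by (intro power_mono) auto
    then have "s\<^sup>2 * J \<le> J * J" by (intro mult_right_mono) (auto simp: J_def)
    also have "\<dots> \<le> (2 * cmod (cinner ?h f)) * (2 * cmod (cinner ?h f))"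
      using J by (intro mult_mono) (auto simp: J_def)
    finally have "J \<le> 4 / s\<^sup>2 * (cmod (cinner ?h f))\<^sup>2" using s by (simp add: field_simps power2_eq_square)
    then show ?thesis using s \<delta> by (simp add: add_increasing)
  qed
  with 1 show ?thesis by (simp add: J_def power_mult_distrib \<delta>)
qed

text \<open>This is \<open>norm_resolvent_le_energy\<close> averaged over the circle |w|^2 = t,
  where Parseval's identity turns each mean into a power series in t. The bound \<open>L\<close>
  survives on the left because the weights (1 - t) t^n have sum 1. On the right the series with
  \<open>d j\<close> and with \<open>f\<close> are replaced by their values at t = 1, while those
  with \<open>bwd\<close> are kept as Abel means.\<close>

lemma mean_energy_le:
  assumes t: "0 \<le> t" "t < 1" and s: "0 < s"
    and S: "summable (\<lambda>n. (cmod (cinner ((T ^^ n) f) f))\<^sup>2)"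
    and L: "\<And>n. L \<le> (norm ((T ^^ n) f))\<^sup>2"
  shows "L \<le> 1 / s + s ^ 3 / 4 * ((1 - t) * (\<Sum>n. t ^ n * (norm ((bwd ^^ n) f))\<^sup>2))
    + ((norm f)\<^sup>2 / s + (\<Sum>j\<in>I. s ^ 3 / 4 * ((1 - t) * (\<Sum>n. t ^ n * (norm ((bwd ^^ n) (v j)))\<^sup>2))))
    + 4 / s\<^sup>2 * (\<Sum>n. (cmod (cinner ((T ^^ n) f) f))\<^sup>2)"
proof -
  define r where "r = sqrt t"
  have r: "0 \<le> r" "r < 1" "r\<^sup>2 = t" using t by (auto simp: r_def)
  define w where "w \<theta> = of_real r * cis \<theta>" for \<theta>
  have w: "cmod (w \<theta>) = r" for \<theta> using r by (simp add: w_def norm_mult)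
  define A where "A j = (\<Sum>n. t ^ n * (cmod (cinner ((T ^^ n) f) (d j)))\<^sup>2)" for j
  have k: "((\<lambda>\<theta>. (cmod (cinner (resolvent f (w \<theta>)) y))\<^sup>2) has_integral
      2 * pi * (\<Sum>n. t ^ n * (cmod (cinner ((T ^^ n) f) y))\<^sup>2)) {0..2 * pi}" for y
    using parseval_scalar[of "\<lambda>n. cinner ((T ^^ n) f) y" "norm f * norm y", OF _ r(1,2)]
      order_trans[OF cinner_norm_le mult_right_mono[OF norm_funpow_T_le norm_ge_zero]]
    by (simp add: cinner_resolvent w r flip: w_def)
  have h: "((\<lambda>\<theta>. (norm (resolvent f (w \<theta>)))\<^sup>2) has_integral
      2 * pi * (\<Sum>n. t ^ n * (norm ((T ^^ n) f))\<^sup>2)) {0..2 * pi}"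
    using parseval[of "\<lambda>n. (T ^^ n) f" "norm f", OF norm_funpow_T_le r(1,2)] by (simp add: r resolvent_def flip: w_def)
  have q: "((\<lambda>\<theta>. (norm (shift_resolvent y (w \<theta>)))\<^sup>2) has_integral
      2 * pi * (\<Sum>n. t ^ n * (norm ((bwd ^^ n) y))\<^sup>2)) {0..2 * pi}" for y
    using parseval[of "\<lambda>n. (bwd ^^ n) y" "norm y", OF norm_funpow_bwd_le r(1,2)] by (simp add: r shift_resolvent_def flip: w_def)
  have one: "((\<lambda>\<theta>. 1 / s) has_integral 2 * pi * (1 / s)) {0..2 * pi}"
    using has_integral_const_real[of "1 / s" 0 "2 * pi"] by simp
  have "(1 - t) * (2 * pi * (\<Sum>n. t ^ n * (norm ((T ^^ n) f))\<^sup>2)) \<le>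
     2 * pi * (1 / s) + s ^ 3 / 4 * (1 - t) * (2 * pi * (\<Sum>n. t ^ n * (norm ((bwd ^^ n) f))\<^sup>2))
    + (\<Sum>j\<in>I. 2 * pi * A j / s + s ^ 3 / 4 * (1 - t) * (2 * pi * (\<Sum>n. t ^ n * (norm ((bwd ^^ n) (v j)))\<^sup>2)))
    + 4 / s\<^sup>2 * (2 * pi * (\<Sum>n. t ^ n * (cmod (cinner ((T ^^ n) f) f))\<^sup>2))"
  proof (rule has_integral_le)
    show "((\<lambda>\<theta>. (1 - t) * (norm (resolvent f (w \<theta>)))\<^sup>2) has_integral
        (1 - t) * (2 * pi * (\<Sum>n. t ^ n * (norm ((T ^^ n) f))\<^sup>2))) {0..2 * pi}"
      by (intro has_integral_mult_right h)
    show "((\<lambda>\<theta>. 1 / s + s ^ 3 / 4 * (1 - t) * (norm (shift_resolvent f (w \<theta>)))\<^sup>2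
        + (\<Sum>j\<in>I. (cmod (cinner (resolvent f (w \<theta>)) (d j)))\<^sup>2 / s
         + s ^ 3 / 4 * (1 - t) * (norm (shift_resolvent (v j) (w \<theta>)))\<^sup>2)
        + 4 / s\<^sup>2 * (cmod (cinner (resolvent f (w \<theta>)) f))\<^sup>2) has_integral
       2 * pi * (1 / s) + s ^ 3 / 4 * (1 - t) * (2 * pi * (\<Sum>n. t ^ n * (norm ((bwd ^^ n) f))\<^sup>2))
    + (\<Sum>j\<in>I. 2 * pi * A j / s + s ^ 3 / 4 * (1 - t) * (2 * pi * (\<Sum>n. t ^ n * (norm ((bwd ^^ n) (v j)))\<^sup>2)))
    + 4 / s\<^sup>2 * (2 * pi * (\<Sum>n. t ^ n * (cmod (cinner ((T ^^ n) f) f))\<^sup>2))) {0..2 * pi}"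
      unfolding A_def
      by (intro has_integral_add has_integral_sum has_integral_mult_right has_integral_divide one k q finite_I)
    show "(1 - t) * (norm (resolvent f (w \<theta>)))\<^sup>2 \<le> 1 / s + s ^ 3 / 4 * (1 - t) * (norm (shift_resolvent f (w \<theta>)))\<^sup>2
        + (\<Sum>j\<in>I. (cmod (cinner (resolvent f (w \<theta>)) (d j)))\<^sup>2 / s
         + s ^ 3 / 4 * (1 - t) * (norm (shift_resolvent (v j) (w \<theta>)))\<^sup>2)
        + 4 / s\<^sup>2 * (cmod (cinner (resolvent f (w \<theta>)) f))\<^sup>2" for \<theta>
      using norm_resolvent_le_energy[of "w \<theta>" s f] r s by (simp add: w)
  qed
  also have "\<dots> = 2 * pi * (1 / s + s ^ 3 / 4 * ((1 - t) * (\<Sum>n. t ^ n * (norm ((bwd ^^ n) f))\<^sup>2))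
    + ((\<Sum>j\<in>I. A j) / s + (\<Sum>j\<in>I. s ^ 3 / 4 * ((1 - t) * (\<Sum>n. t ^ n * (norm ((bwd ^^ n) (v j)))\<^sup>2))))
    + 4 / s\<^sup>2 * (\<Sum>n. t ^ n * (cmod (cinner ((T ^^ n) f) f))\<^sup>2))"
    by (simp add: sum.distrib sum_divide_distrib sum_distrib_left distrib_left mult_ac)
  finally have main: "(1 - t) * (\<Sum>n. t ^ n * (norm ((T ^^ n) f))\<^sup>2) \<le> 
     1 / s + s ^ 3 / 4 * ((1 - t) * (\<Sum>n. t ^ n * (norm ((bwd ^^ n) f))\<^sup>2))
    + ((\<Sum>j\<in>I. A j) / s + (\<Sum>j\<in>I. s ^ 3 / 4 * ((1 - t) * (\<Sum>n. t ^ n * (norm ((bwd ^^ n) (v j)))\<^sup>2))))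
    + 4 / s\<^sup>2 * (\<Sum>n. t ^ n * (cmod (cinner ((T ^^ n) f) f))\<^sup>2)"
    by (simp add: mult.left_commute[of "1 - t" "2 * pi"] mult_le_cancel_left_pos)
  have damp: "(\<Sum>n. t ^ n * b n) \<le> (\<Sum>n. b n)" if b: "summable b" "\<And>n. 0 \<le> b n" for b :: "nat \<Rightarrow> real"
  proof (rule suminf_le)
    show le: "t ^ n * b n \<le> b n" for n using t b(2) by (intro mult_left_le_one_le power_le_one) auto
    show "summable (\<lambda>n. t ^ n * b n)"
      by (rule summable_comparison_test'[OF b(1), of 0]) (use le t b(2) in auto)
  qed (rule b)
  have "(\<Sum>j\<in>I. A j) \<le> (\<Sum>j\<in>I. \<Sum>n. (cmod (cinner ((T ^^ n) f) (d j)))\<^sup>2)"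
    unfolding A_def by (intro sum_mono damp summable_energy) auto
  also have "\<dots> \<le> (norm f)\<^sup>2" by (rule energy_suminf_le)
  finally have A: "(\<Sum>j\<in>I. A j) / s \<le> (norm f)\<^sup>2 / s" using s by (intro divide_right_mono) auto
  have B: "4 / s\<^sup>2 * (\<Sum>n. t ^ n * (cmod (cinner ((T ^^ n) f) f))\<^sup>2) \<le> 4 / s\<^sup>2 * (\<Sum>n. (cmod (cinner ((T ^^ n) f) f))\<^sup>2)"
    using s by (intro mult_left_mono damp S) auto
  have geo: "(\<lambda>n. t ^ n * c) sums (1 / (1 - t) * c)" for c
    using t by (intro sums_mult2 geometric_sums) auto
  have "1 / (1 - t) * L \<le> (\<Sum>n. t ^ n * (norm ((T ^^ n) f))\<^sup>2)"
  proof (rule sums_le[OF _ geo summable_sums])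
    show "t ^ n * L \<le> t ^ n * (norm ((T ^^ n) f))\<^sup>2" for n using t L by (intro mult_left_mono) auto
    show "summable (\<lambda>n. t ^ n * (norm ((T ^^ n) f))\<^sup>2)"
      by (rule summable_comparison_test'[OF sums_summable[OF geo[of "(norm f)\<^sup>2"]], of 0])
         (use t norm_funpow_T_le in \<open>auto intro!: mult_left_mono power_mono\<close>)
  qed
  then have "L \<le> (1 - t) * (\<Sum>n. t ^ n * (norm ((T ^^ n) f))\<^sup>2)" using t by (simp add: field_simps)
  with main A B show ?thesis by linarith
qed

lemma funpow_tendsto_0_of_summable:
  assumes S: "summable (\<lambda>n. (cmod (cinner ((T ^^ n) f) f))\<^sup>2)"
  shows "(\<lambda>n. (T ^^ n) f) \<longlonglongrightarrow> 0"
proof -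
  have "decseq (\<lambda>n. norm ((T ^^ n) f))" using norm_funpow_T_decreasing by (simp add: decseq_def)
  then obtain l where l: "(\<lambda>n. norm ((T ^^ n) f)) \<longlonglongrightarrow> l" "\<And>n. l \<le> norm ((T ^^ n) f)"
    using decseq_convergent[of "\<lambda>n. norm ((T ^^ n) f)" 0] by auto
  have l0: "l \<ge> 0" using LIMSEQ_le_const[OF l(1), of 0] by auto
  have L: "l\<^sup>2 \<le> (norm ((T ^^ n) f))\<^sup>2" for n using l(2) l0 by (intro power_mono) auto
  define C where "C = (\<Sum>n. (cmod (cinner ((T ^^ n) f) f))\<^sup>2)"
  have lim: "((\<lambda>t. (1 - t) * (\<Sum>n. t ^ n * (norm ((bwd ^^ n) y))\<^sup>2)) \<longlongrightarrow> 0) (at_left 1)" for y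
    using tendsto_power[OF tendsto_norm[OF bwd_funpow_tendsto_0[of y]], of 2]
    by (intro abel_mean_tendsto_0) simp
  \<comment> \<open>The order of the limits matters: t tends to 1 while \<open>s\<close> is fixed,
    which removes the terms with \<open>s ^ 3\<close>, and only then does \<open>s\<close> run
    through the positive integers.\<close>
  have "l\<^sup>2 \<le> 1 / s + (norm f)\<^sup>2 / s + 4 / s\<^sup>2 * C" if s: "0 < s" for s
  proof (rule tendsto_lowerbound)
    have "((\<lambda>t. 1 / s + s ^ 3 / 4 * ((1 - t) * (\<Sum>n. t ^ n * (norm ((bwd ^^ n) f))\<^sup>2))
    + ((norm f)\<^sup>2 / s + (\<Sum>j\<in>I. s ^ 3 / 4 * ((1 - t) * (\<Sum>n. t ^ n * (norm ((bwd ^^ n) (v j)))\<^sup>2))))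
    + 4 / s\<^sup>2 * C) \<longlongrightarrow> 1 / s + s ^ 3 / 4 * 0 + ((norm f)\<^sup>2 / s + (\<Sum>j\<in>I. s ^ 3 / 4 * 0)) + 4 / s\<^sup>2 * C) (at_left 1)"
      by (intro tendsto_add tendsto_const tendsto_mult_left tendsto_sum lim)
    then show "((\<lambda>t. 1 / s + s ^ 3 / 4 * ((1 - t) * (\<Sum>n. t ^ n * (norm ((bwd ^^ n) f))\<^sup>2))
    + ((norm f)\<^sup>2 / s + (\<Sum>j\<in>I. s ^ 3 / 4 * ((1 - t) * (\<Sum>n. t ^ n * (norm ((bwd ^^ n) (v j)))\<^sup>2))))
    + 4 / s\<^sup>2 * C) \<longlongrightarrow> 1 / s + (norm f)\<^sup>2 / s + 4 / s\<^sup>2 * C) (at_left 1)" by simp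
    show "\<forall>\<^sub>F t in at_left 1. l\<^sup>2 \<le> 1 / s + s ^ 3 / 4 * ((1 - t) * (\<Sum>n. t ^ n * (norm ((bwd ^^ n) f))\<^sup>2))
    + ((norm f)\<^sup>2 / s + (\<Sum>j\<in>I. s ^ 3 / 4 * ((1 - t) * (\<Sum>n. t ^ n * (norm ((bwd ^^ n) (v j)))\<^sup>2))))
    + 4 / s\<^sup>2 * C"
      unfolding C_def
      by (rule eventually_at_leftI[of 0], rule mean_energy_le[OF _ _ s S L]) auto
  qed simp
  then have "\<forall>n. l\<^sup>2 \<le> 1 / real (Suc n) + (norm f)\<^sup>2 / real (Suc n) + 4 / (real (Suc n))\<^sup>2 * C" by simp
  moreover have "(\<lambda>n. 1 / real (Suc n) + (norm f)\<^sup>2 / real (Suc n) + 4 / (real (Suc n))\<^sup>2 * C) \<longlonglongrightarrow> 0"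
    by real_asymp
  ultimately have "l\<^sup>2 \<le> 0" by (intro LIMSEQ_le_const[of _ 0]) auto
  then have "l = 0" by simp
  with l(1) show ?thesis using tendsto_norm_zero_iff by blast
qed

definition T_adj :: "ell2 \<Rightarrow> ell2" where
  "T_adj y = fwd y - (\<Sum>j\<in>I. cscale (cinner y (v j)) (d j))"

lemma cinner_T: "cinner (T x) y = cinner x (T_adj y)"
proof -
  have "cnj (cinner y (v j)) = cinner (v j) y" for j by (rule cinner_commute[symmetric])
  then show ?thesis
    by (simp add: T_eq T_adj_def cinner_diff_left cinner_diff_right cinner_sum_left cinner_sum_right cinner_bwd mult.commute)
qed

lemma cinner_funpow_T: "cinner ((T ^^ n) x) y = cinner x ((T_adj ^^ n) y)"
  by (induction n arbitrary: y) (simp_all add: cinner_T funpow_swap1[of T_adj])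

theorem funpow_tendsto_0: "(\<lambda>n. (T ^^ n) x) \<longlonglongrightarrow> 0"
proof -
  define N where "N = {f. (\<lambda>n. (T ^^ n) f) \<longlonglongrightarrow> 0}"
  have sub: "csubspace N"
    unfolding csubspace_def N_def
  proof (intro conjI ballI allI, unfold mem_Collect_eq funpow_T_linear)
    fix x y c assume "(\<lambda>n. (T ^^ n) x) \<longlonglongrightarrow> 0" "(\<lambda>n. (T ^^ n) y) \<longlonglongrightarrow> 0"
    then show "(\<lambda>n. (T ^^ n) x + (T ^^ n) y) \<longlonglongrightarrow> 0" using tendsto_add by fastforce
  next
    fix x c assume "(\<lambda>n. (T ^^ n) x) \<longlonglongrightarrow> 0"
    then show "(\<lambda>n. cscale c ((T ^^ n) x)) \<longlonglongrightarrow> 0"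
      using bounded_linear.tendsto[OF bounded_bilinear.bounded_linear_right[OF bounded_bilinear_cscale]]
      by fastforce
  qed simp
  \<comment> \<open>All powers of \<open>T\<close> are contractions, so replacing \<open>f\<close>
    by a nearby \<open>F k\<close> changes every iterate by less than e / 2 at once.\<close>
  have "closed N"
    unfolding closed_sequential_limits
  proof (intro allI impI, elim conjE)
    fix F f assume F: "\<forall>k. F k \<in> N" "F \<longlonglongrightarrow> f"
    show "f \<in> N"
      unfolding N_def mem_Collect_eq
    proof (rule LIMSEQ_I)
      fix e :: real assume e: "e > 0"
      obtain k where k: "norm (F k - f) < e / 2" using LIMSEQ_D[OF F(2), of "e / 2"] e by auto
      have "(\<lambda>n. (T ^^ n) (F k)) \<longlonglongrightarrow> 0" using F(1) by (simp add: N_def)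
      then obtain M where M: "\<And>n. n \<ge> M \<Longrightarrow> norm ((T ^^ n) (F k)) < e / 2"
        using LIMSEQ_D[of "\<lambda>n. (T ^^ n) (F k)" 0 "e / 2"] e by auto
      have "norm ((T ^^ n) f) < e" if "n \<ge> M" for n
      proof -
        have "(T ^^ n) f = (T ^^ n) (F k) - (T ^^ n) (F k - f)" by (simp add: funpow_T_linear)
        then have "norm ((T ^^ n) f) \<le> norm ((T ^^ n) (F k)) + norm ((T ^^ n) (F k - f))"
          by (metis norm_triangle_ineq4)
        also have "\<dots> < e" using M[OF that] k norm_funpow_T_le[of n "F k - f"] by linarith
        finally show ?thesis .
      qed
      then show "\<exists>no. \<forall>n\<ge>no. norm ((T ^^ n) f - 0) < e" by auto
    qed
  qed
  obtain y where y: "y \<in> N" "\<And>z. z \<in> N \<Longrightarrow> cinner (x - y) z = 0"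
    using orthogonal_projection_exists[OF sub \<open>closed N\<close>, of x] by blast
  have in_N: "(T_adj ^^ m) (d j) \<in> N" if j: "j \<in> I" for m j
  proof -
    let ?f = "(T_adj ^^ m) (d j)"
    have "cinner ((T ^^ n) ?f) ?f = cinner ((T ^^ (n + m)) ?f) (d j)" for n
      by (simp add: cinner_funpow_T[symmetric] add.commute[of n m] funpow_add)
    then have "summable (\<lambda>n. (cmod (cinner ((T ^^ n) ?f) ?f))\<^sup>2)"
      using summable_ignore_initial_segment[OF summable_energy[OF j, of ?f], of m] by simp
    then show ?thesis using funpow_tendsto_0_of_summable by (simp add: N_def)
  qed
  define z where "z = x - y"
  have orth: "cinner ((T ^^ n) z) (d j) = 0" if "j \<in> I" for n j
    using y(2)[OF in_N[OF that, of n]] by (simp add: cinner_funpow_T z_def)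
  have "T ((T ^^ n) z) = bwd ((T ^^ n) z)" for n
    by (subst T_eq) (simp add: orth sum.neutral)
  then have "(T ^^ n) z = (bwd ^^ n) z" for n by (induction n) (simp, metis funpow.simps(2) comp_apply)
  moreover have "norm ((T ^^ n) z) = norm z" for n
    using energy_funpow[of z n] by (simp add: orth power2_eq_iff_nonneg)
  ultimately have "norm z = 0"
    using tendsto_norm[OF bwd_funpow_tendsto_0[of z]] by (simp add: LIMSEQ_const_iff)
  then show ?thesis using y(1) by (simp add: z_def N_def)
qed

end

section \<open>Nearly invariant subspaces of H2\<close>

lemma summable_eval:
  assumes "cmod z < 1"
  shows "summable (\<lambda>n. coord x n * z ^ n)"
proof (rule summable_comparison_test'[where N = 0])
  show "summable (\<lambda>n. norm x * cmod z ^ n)"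
    using assms by (intro summable_mult summable_geometric) simp
  show "norm (coord x n * z ^ n) \<le> norm x * cmod z ^ n" for n
    by (simp add: norm_mult norm_power mult_right_mono coord_le_norm)
qed

definition of_ell2 :: "ell2 \<Rightarrow> complex \<Rightarrow> complex" where
  "of_ell2 x z = (if z \<in> ball 0 1 then \<Sum>n. coord x n * z ^ n else 0)"

lemma of_ell2_sums: "cmod z < 1 \<Longrightarrow> (\<lambda>n. coord x n * z ^ n) sums of_ell2 x z"
  by (simp add: of_ell2_def summable_eval summable_sums)

lemma of_ell2_outside: "\<not> cmod z < 1 \<Longrightarrow> of_ell2 x z = 0"
  by (simp add: of_ell2_def)

lemma of_ell2_eqI: "(\<And>z. cmod z < 1 \<Longrightarrow> of_ell2 x z = f z) \<Longrightarrow> (\<And>z. \<not> cmod z < 1 \<Longrightarrow> f z = 0) \<Longrightarrow> of_ell2 x = f"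
  by (metis ext of_ell2_outside)

text \<open>Evaluation at a fixed point of the disc is bounded. A crude constant suffices, since it
  is only needed to remove the remainder in \<open>of_ell2_eq\<close>.\<close>

lemma norm_of_ell2_le:
  assumes "cmod z < 1"
  shows "cmod (of_ell2 x z) \<le> norm x / (1 - cmod z)"
proof -
  have geo: "(\<lambda>n. norm x * cmod z ^ n) sums (norm x * (1 / (1 - cmod z)))"
    using assms by (intro sums_mult geometric_sums) simp
  have "cmod (\<Sum>n. coord x n * z ^ n) \<le> (\<Sum>n. norm x * cmod z ^ n)"
    by (rule norm_suminf_le[OF _ sums_summable[OF geo]])
       (simp add: norm_mult norm_power mult_right_mono coord_le_norm)
  then show ?thesis using assms sums_unique[OF geo] by (simp add: of_ell2_def)
qed

lemma of_ell2_holomorphic: "of_ell2 x holomorphic_on ball 0 1"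
  by (rule power_series_holomorphic[where a = "coord x"]) (simp add: of_ell2_sums)

lemma taylor_coeff_of_ell2 [simp]: "taylor_coeff (of_ell2 x) = coord x"
proof
  fix n
  \<comment> \<open>The point 1/2 is arbitrary: an expansion at 0 only asks for a positive radius of
    convergence.\<close>
  have "fps_conv_radius (Abs_fps (coord x)) \<ge> norm (1 / 2 :: complex)"
    unfolding fps_conv_radius_def by (rule conv_radius_geI) (simp add: summable_eval)
  moreover have "(0 :: ereal) < ereal (norm (1 / 2 :: complex))" by simp
  ultimately have "fps_conv_radius (Abs_fps (coord x)) > 0" by (rule less_le_trans[rotated])
  moreover have "eventually (\<lambda>z. z \<in> ball 0 1) (nhds (0 :: complex))"
    by (intro eventually_nhds_in_open) auto
  then have "eventually (\<lambda>z. eval_fps (Abs_fps (coord x)) z = of_ell2 x z) (nhds 0)"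
    by eventually_elim (simp add: eval_fps_def of_ell2_def)
  ultimately have "of_ell2 x has_fps_expansion Abs_fps (coord x)" by (simp add: has_fps_expansion_def)
  from fps_nth_fps_expansion[OF this, of n] show "taylor_coeff (of_ell2 x) n = coord x n"
    by (simp add: taylor_coeff_def)
qed

lemma of_ell2_in_H2 [simp]: "of_ell2 x \<in> H2"
  by (auto simp: H2_def of_ell2_holomorphic of_ell2_def summable_coord)

lemma of_ell2_Abs_ell2_taylor:
  assumes "f \<in> H2"
  shows "of_ell2 (Abs_ell2 (taylor_coeff f)) = f"
proof (rule of_ell2_eqI)
  have c: "coord (Abs_ell2 (taylor_coeff f)) = taylor_coeff f"
    using assms by (simp add: H2_def Abs_ell2_inverse)
  fix z :: complex assume "cmod z < 1"
  then have "(\<lambda>n. taylor_coeff f n * z ^ n) sums f z"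
    using holomorphic_power_series[of f 0 1 z] assms by (simp add: H2_def taylor_coeff_def)
  then show "of_ell2 (Abs_ell2 (taylor_coeff f)) z = f z"
    using \<open>cmod z < 1\<close> by (simp add: of_ell2_def c sums_iff)
qed (use assms in \<open>simp add: H2_def\<close>)

lemma H2_eq_range_of_ell2: "H2 = range of_ell2"
  using of_ell2_Abs_ell2_taylor of_ell2_in_H2 by (metis UNIV_I image_subset_iff rangeI subsetI subset_antisym)

lemma of_ell2_inject [simp]: "of_ell2 x = of_ell2 y \<longleftrightarrow> x = y"
  by (metis coord_inject taylor_coeff_of_ell2)

lemma H2_inner_of_ell2 [simp]: "H2_inner (of_ell2 x) (of_ell2 y) = cinner x y"
  by (simp add: H2_inner_def cinner_def)

lemma H2_norm_of_ell2 [simp]: "H2_norm (of_ell2 x) = norm x"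
  by (simp add: H2_norm_def norm_ell2_eq)

lemma of_ell2_add: "of_ell2 (x + y) = of_ell2 x + of_ell2 y"
  by (rule of_ell2_eqI)
     (simp_all add: of_ell2_def distrib_right suminf_add summable_eval)

lemma of_ell2_cscale: "of_ell2 (cscale c x) = fscale c (of_ell2 x)"
  by (rule of_ell2_eqI)
     (simp_all add: of_ell2_def fscale_def mult.assoc suminf_mult summable_eval)

lemma of_ell2_zero [simp]: "of_ell2 0 = 0"
  by (rule of_ell2_eqI) (simp_all add: of_ell2_def)

lemma of_ell2_diff: "of_ell2 (x - y) = of_ell2 x - of_ell2 y"
  by (rule of_ell2_eqI)
     (simp_all add: of_ell2_def left_diff_distrib suminf_diff summable_eval)

lemma of_ell2_sum: "of_ell2 (\<Sum>j\<in>A. x j) z = (\<Sum>j\<in>A. of_ell2 (x j) z)"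
  by (induction A rule: infinite_finite_induct) (auto simp: of_ell2_add)

lemma of_ell2_at_0: "of_ell2 x 0 = coord x 0"
  by (simp add: of_ell2_def)

lemma coord_0_eq_cinner: "coord x 0 = cinner x unit0"
proof -
  have "(\<lambda>n. coord x n * cnj (coord unit0 n)) = (\<lambda>n. if n = 0 then coord x n else 0)"
    by (auto simp: unit0.rep_eq)
  then show ?thesis using sums_unique[OF sums_single[of 0 "coord x"]] by (simp add: cinner_def)
qed

lemma of_ell2_bwd_eq:
  assumes "cmod z < 1"
  shows "of_ell2 x z = coord x 0 + z * of_ell2 (bwd x) z"
proof -
  have "(\<lambda>n. z * (coord (bwd x) n * z ^ n)) sums (z * of_ell2 (bwd x) z)"
    by (intro sums_mult of_ell2_sums assms)
  then have "(\<lambda>n. coord x (Suc n) * z ^ Suc n) sums (z * of_ell2 (bwd x) z)"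
    by (simp add: mult_ac)
  from sums_Suc[OF this] show ?thesis
    using of_ell2_sums[OF assms, of x] by (auto simp: add.commute dest: sums_unique2)
qed

lemma bshift_of_ell2: "bshift (of_ell2 x) = of_ell2 (bwd x)"
proof (rule of_ell2_eqI[symmetric])
  fix z :: complex assume z: "cmod z < 1"
  show "of_ell2 (bwd x) z = bshift (of_ell2 x) z"
  proof (cases "z = 0")
    case True
    have "deriv (of_ell2 x) 0 = coord x 1"
      using fun_cong[OF taylor_coeff_of_ell2[of x], of 1] unfolding taylor_coeff_def by simp
    then show ?thesis using True by (simp add: bshift_def of_ell2_at_0)
  next
    case False
    then show ?thesis using z of_ell2_bwd_eq[OF z, of x] by (simp add: bshift_def of_ell2_at_0)
  qed
qed (simp add: bshift_def)

lemma H2_closed_subspace_vimage: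
  assumes "H2_closed_subspace M"
  shows "csubspace (of_ell2 -` M)" "closed (of_ell2 -` M)" "f \<in> M \<Longrightarrow> \<exists>x. f = of_ell2 x"
proof -
  have M: "M \<subseteq> H2" "H2fun.subspace M"
    and cl: "\<And>X f. (\<And>n. X n \<in> M) \<Longrightarrow> f \<in> H2 \<Longrightarrow> (\<lambda>n :: nat. H2_norm (X n - f)) \<longlonglongrightarrow> 0 \<Longrightarrow> f \<in> M"
    using assms by (auto simp: H2_closed_subspace_def)
  show "csubspace (of_ell2 -` M)"
    using M(2) by (auto simp: csubspace_def H2fun.subspace_def of_ell2_add of_ell2_cscale)
  show "closed (of_ell2 -` M)"
    unfolding closed_sequential_limits
  proof (intro allI impI, elim conjE)
    fix X x assume X: "\<forall>n. X n \<in> of_ell2 -` M" "X \<longlonglongrightarrow> x"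
    have "(\<lambda>n. norm (X n - x)) \<longlonglongrightarrow> 0" using X(2) by (simp add: LIM_zero tendsto_norm_zero)
    then have "(\<lambda>n. H2_norm (of_ell2 (X n) - of_ell2 x)) \<longlonglongrightarrow> 0" by (simp flip: of_ell2_diff)
    from cl[OF _ of_ell2_in_H2 this] X(1) show "x \<in> of_ell2 -` M" by simp
  qed
  show "\<exists>x. f = of_ell2 x" if "f \<in> M" using M(1) that by (auto simp: H2_eq_range_of_ell2)
qed

text \<open>Evaluation at 0 is the inner product with the constant 1, so the kernel is the
  projection of 1 onto \<open>M\<close>. Its value at 0 is the square of its norm; hence it equals
  g(0) g, which gives the last conclusion.\<close>

lemma kernel_at_0_eq:
  assumes M: "H2_closed_subspace M" and nz: "f \<in> M" "f 0 \<noteq> 0"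
  obtains g where "of_ell2 g \<in> M" "normalized_kernel_at_0 M = of_ell2 g" "norm g = 1" "coord g 0 \<noteq> 0"
    "\<And>x. of_ell2 x \<in> M \<Longrightarrow> coord x 0 = cinner x g * coord g 0"
proof -
  note N = H2_closed_subspace_vimage[OF M]
  obtain \<kappa> where \<kappa>: "\<kappa> \<in> of_ell2 -` M" "\<And>z. z \<in> of_ell2 -` M \<Longrightarrow> cinner (unit0 - \<kappa>) z = 0"
    using orthogonal_projection_exists[OF N(1,2), of unit0] by blast
  have ev: "cinner x \<kappa> = coord x 0" if "of_ell2 x \<in> M" for x
  proof -
    have "cinner unit0 x = cinner \<kappa> x" using \<kappa>(2)[of x] that by (simp add: cinner_diff_left)
    then show ?thesis by (metis coord_0_eq_cinner cinner_commute)
  qed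
  have ker: "kernel_at_0 M = of_ell2 \<kappa>"
    unfolding kernel_at_0_def
  proof (rule the_equality)
    have "H2_inner f (of_ell2 \<kappa>) = f 0" if f: "f \<in> M" for f
    proof -
      obtain x where "f = of_ell2 x" using f N(3) by blast
      then show ?thesis using ev f by (simp add: of_ell2_at_0)
    qed
    then show "of_ell2 \<kappa> \<in> M \<and> (\<forall>f\<in>M. H2_inner f (of_ell2 \<kappa>) = f 0)" using \<kappa>(1) by simp
    fix g assume g: "g \<in> M \<and> (\<forall>f\<in>M. H2_inner f g = f 0)"
    then obtain y where y: "g = of_ell2 y" using N(3) by blast
    have "of_ell2 (\<kappa> - y) \<in> M" using \<kappa>(1) g y csubspaceD(4)[OF N(1), of \<kappa> y] by auto
    then have "cinner (\<kappa> - y) \<kappa> = coord (\<kappa> - y) 0" "H2_inner (of_ell2 (\<kappa> - y)) (of_ell2 y) = of_ell2 (\<kappa> - y) 0"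
      using ev g y by blast+
    then have "cinner (\<kappa> - y) \<kappa> = cinner (\<kappa> - y) y" by (simp only: H2_inner_of_ell2 of_ell2_at_0)
    then have "cinner (\<kappa> - y) (\<kappa> - y) = 0" by (simp add: cinner_diff_right)
    then show "g = of_ell2 \<kappa>" by (simp add: cinner_self y)
  qed
  obtain x where "f = of_ell2 x" using nz(1) N(3) by blast
  \<comment> \<open>A function of \<open>M\<close> that does not vanish at 0 shows that the kernel
    is not 0, so that it can be normalized.\<close>
  then have "cinner x \<kappa> \<noteq> 0" using nz ev by (simp add: of_ell2_at_0)
  then have "norm \<kappa> \<noteq> 0" by auto
  define g where "g = cscale (of_real (1 / norm \<kappa>)) \<kappa>"
  have g0: "coord g 0 = norm \<kappa>"
  proof -
    have "coord \<kappa> 0 = of_real ((norm \<kappa>)\<^sup>2)" using ev[of \<kappa>] \<kappa>(1) by (simp add: cinner_self)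
    then show ?thesis using \<open>norm \<kappa> \<noteq> 0\<close> by (simp add: g_def power2_eq_square)
  qed
  show ?thesis
  proof (rule that)
    show "of_ell2 g \<in> M" using csubspaceD(3)[OF N(1) \<kappa>(1)] by (simp add: g_def)
    show "normalized_kernel_at_0 M = of_ell2 g"
      by (auto simp: normalized_kernel_at_0_def ker g_def of_ell2_cscale fscale_def)
    show "norm g = 1" using \<open>norm \<kappa> \<noteq> 0\<close> by (simp add: g_def norm_divide)
    show "coord g 0 \<noteq> 0" using \<open>norm \<kappa> \<noteq> 0\<close> by (simp add: g0)
    show "coord x 0 = cinner x g * coord g 0" if "of_ell2 x \<in> M" for x
      using ev[OF that] \<open>norm \<kappa> \<noteq> 0\<close> unfolding g0 by (simp add: g_def)
  qed
qed

lemma orthonormal_basis_of_ell2: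
  assumes "H2_subspace_dim m F" "H2_orthonormal_basis m e F"
  obtains u where "\<And>j. j \<in> {1..m} \<Longrightarrow> e j = of_ell2 (u j)"
    "\<And>j. j \<in> {1..m} \<Longrightarrow> e j \<in> F"
    "\<And>i j. i \<in> {1..m} \<Longrightarrow> j \<in> {1..m} \<Longrightarrow> cinner (u i) (u j) = (if i = j then 1 else 0)"
proof -
  define u where "u j = Abs_ell2 (taylor_coeff (e j))" for j
  have F: "e j \<in> F" if "j \<in> {1..m}" for j
  proof -
    have "e j \<in> e ` {1..m}" using that by (rule imageI)
    also have "\<dots> \<subseteq> H2fun.span (e ` {1..m})" by (rule H2fun.span_superset)
    also have "\<dots> = F" using assms(2) by (simp only: H2_orthonormal_basis_def)
    finally show ?thesis .
  qed
  have "e j = of_ell2 (u j)" if "j \<in> {1..m}" for j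
  proof -
    have "e j \<in> H2" using F[OF that] assms(1) by (auto simp only: H2_subspace_dim_def)
    then show ?thesis by (simp add: u_def of_ell2_Abs_ell2_taylor)
  qed
  moreover from this have "cinner (u i) (u j) = (if i = j then 1 else 0)" if "i \<in> {1..m}" "j \<in> {1..m}" for i j
    using assms(2) that by (metis H2_inner_of_ell2 H2_orthonormal_basis_def)
  ultimately show ?thesis using that F by blast
qed

lemma sum_fun_apply: "(\<Sum>j\<in>A. f j) z = (\<Sum>j\<in>A. f j z)"
  for f :: "'i \<Rightarrow> 'a \<Rightarrow> 'b :: comm_monoid_add"
  by (induction A rule: infinite_finite_induct) auto

text \<open>Coefficients are attached to indices, not to vectors, so \<open>e\<close> need not be
  injective; in the induction only the coefficient of one chosen index \<open>i\<close> with
  \<open>x = e i\<close> is raised.\<close>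

lemma H2fun_span_image:
  assumes "finite A" "h \<in> H2fun.span (e ` A)"
  obtains c where "h = (\<Sum>j\<in>A. fscale (c j) (e j))"
proof -
  have "\<exists>c. h = (\<Sum>j\<in>A. fscale (c j) (e j))"
    using assms(2)
  proof (induction rule: H2fun.span_induct_alt)
    case base
    show ?case by (rule exI[of _ "\<lambda>_. 0"]) (simp add: fscale_def zero_fun_def)
  next
    case (step a x y)
    then obtain c i where c: "y = (\<Sum>j\<in>A. fscale (c j) (e j))" "i \<in> A" "x = e i" by blast
    have "fscale a x + y = (\<Sum>j\<in>A. fscale (c j + (if j = i then a else 0)) (e j))"
      using c assms(1) by (simp add: H2fun.scale_left_distrib sum.distrib if_distrib[of "\<lambda>c. fscale c _"]
        sum.delta fscale_def[of 0] cong: if_cong)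
    then show ?case by (rule exI[of _ "\<lambda>j. c j + (if j = i then a else 0)"])
  qed
  then show ?thesis using that by blast
qed

text \<open>The case \<open>g = 0\<close> covers spaces all of whose functions vanish at \<open>0\<close>.\<close>

locale near_invariance =
  fixes N :: "ell2 set" and m :: nat and g :: ell2 and u :: "nat \<Rightarrow> ell2"
  assumes sub: "csubspace N" and closed: "closed N"
    and g: "g \<in> N" "g = 0 \<or> norm g = 1"
    and coord_0: "\<And>x. x \<in> N \<Longrightarrow> coord x 0 = cinner x g * coord g 0"
    and orthonormal: "\<And>i j. i \<in> {1..m} \<Longrightarrow> j \<in> {1..m} \<Longrightarrow> cinner (u i) (u j) = (if i = j then 1 else 0)"
    and orthogonal: "\<And>x j. x \<in> N \<Longrightarrow> j \<in> {1..m} \<Longrightarrow> cinner x (u j) = 0"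
    and bwd_in: "\<And>x. x \<in> N \<Longrightarrow> coord x 0 = 0 \<Longrightarrow> \<exists>y\<in>N. \<exists>c. bwd x = y + (\<Sum>j=1..m. cscale (c j) (u j))"
begin

text \<open>The projection onto the orthogonal complement of \<open>g\<close>, or the identity if
  \<open>g = 0\<close>. On \<open>N\<close> it also removes the value at 0, by
  \<open>coord_0\<close>.\<close>

definition P :: "ell2 \<Rightarrow> ell2" where "P x = x - cscale (cinner x g) g"

text \<open>For \<open>x\<close> in \<open>N\<close> the function \<open>P x\<close> vanishes at 0,
  so its backward shift lies in the sum of \<open>N\<close> and the span of the \<open>u j\<close>;
  subtracting the projection onto that span leaves the component in \<open>N\<close>.\<close>

definition R :: "ell2 \<Rightarrow> ell2" where
  "R x = bwd (P x) - (\<Sum>j=1..m. cscale (cinner (bwd (P x)) (u j)) (u j))"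

text \<open>The index \<open>Suc m\<close> carries the constant term of \<open>P x\<close>. It is zero on \<open>N\<close>, but without it
  the norm identity would fail off \<open>N\<close>.\<close>

definition d :: "nat \<Rightarrow> ell2" where
  "d j = (if j = 0 then g else if j = Suc m then P unit0 else P (fwd (u j)))"

text \<open>The entry \<open>bwd g\<close> arises because the shift is applied after the component
  along \<open>g\<close> has been removed. With the entry 0, index \<open>Suc m\<close> enters the
  energy but not the map.\<close>

definition v :: "nat \<Rightarrow> ell2" where
  "v j = (if j = 0 then bwd g else if j = Suc m then 0 else u j)"

lemma cinner_P: "cinner (P x) y = cinner x (P y)"
  by (simp add: P_def cinner_diff_left cinner_diff_right cinner_commute[of g y] mult.commute)

lemma norm_P: "(norm x)\<^sup>2 = (norm (P x))\<^sup>2 + (cmod (cinner x g))\<^sup>2"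
proof -
  have "cinner (P x) (cscale (cinner x g) g) = 0"
    using g(2) by (auto simp: P_def cinner_diff_left cinner_self)
  then have "(norm (P x + cscale (cinner x g) g))\<^sup>2 = (norm (P x))\<^sup>2 + (norm (cscale (cinner x g) g))\<^sup>2"
    by (rule pythagoras)
  moreover have "cmod (cinner x g) * norm g = cmod (cinner x g)" using g(2) by auto
  ultimately show ?thesis by (simp add: P_def)
qed

lemma bessel_equality:
  "(norm y)\<^sup>2 = (norm (y - (\<Sum>j=1..m. cscale (cinner y (u j)) (u j))))\<^sup>2 + (\<Sum>j=1..m. (cmod (cinner y (u j)))\<^sup>2)"
proof -
  define s where "s = (\<Sum>j=1..m. cscale (cinner y (u j)) (u j))"
  have su: "cinner s (u i) = cinner y (u i)" if "i \<in> {1..m}" for i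
  proof -
    have "cinner s (u i) = (\<Sum>j=1..m. cinner (cscale (cinner y (u j)) (u j)) (u i))"
      unfolding s_def cinner_sum_left ..
    also have "\<dots> = (\<Sum>j=1..m. if j = i then cinner y (u j) else 0)"
      using that by (intro sum.cong) (auto simp: orthonormal)
    finally have "cinner s (u i) = \<dots>" .
    then show ?thesis using that by simp
  qed
  have cs: "cinner x s = (\<Sum>j=1..m. cnj (cinner y (u j)) * cinner x (u j))" for x
    unfolding s_def cinner_sum_right by simp
  have "cinner s s = (\<Sum>j=1..m. of_real ((cmod (cinner y (u j)))\<^sup>2))"
    unfolding cs using su by (intro sum.cong) (auto simp: complex_norm_square mult.commute simp del: of_real_power)
  then have ss: "(norm s)\<^sup>2 = (\<Sum>j=1..m. (cmod (cinner y (u j)))\<^sup>2)"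
    unfolding cinner_self by (metis of_real_eq_iff of_real_sum)
  have "cinner (y - s) s = 0"
    unfolding cs using su by (intro sum.neutral) (simp add: cinner_diff_left)
  then have "(norm ((y - s) + s))\<^sup>2 = (norm (y - s))\<^sup>2 + (norm s)\<^sup>2" by (rule pythagoras)
  then show ?thesis unfolding ss by (simp add: s_def)
qed

lemma cinner_d: 
  "cinner x (d 0) = cinner x g"
  "j \<in> {1..m} \<Longrightarrow> cinner x (d j) = cinner (bwd (P x)) (u j)"
  "cinner x (d (Suc m)) = coord (P x) 0"
  by (auto simp: d_def cinner_P[symmetric] cinner_bwd coord_0_eq_cinner)

lemma index_sum: "(\<Sum>j\<in>{0..Suc m}. h j) = h 0 + (\<Sum>j=1..m. h j) + h (Suc m)"
  for h :: "nat \<Rightarrow> 'a :: comm_monoid_add"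
  by (simp add: sum.atLeast_Suc_atMost)

text \<open>Each operation in \<open>R\<close> has its own Pythagorean identity:
  \<open>norm_P\<close> accounts for index 0, \<open>norm_bwd\<close> for \<open>Suc m\<close>, and
  \<open>bessel_equality\<close> for the indices from 1 to \<open>m\<close>.\<close>

sublocale shift_perturbation R "{0..Suc m}" d v
proof
  fix x
  show "R x = bwd x - (\<Sum>j\<in>{0..Suc m}. cscale (cinner x (d j)) (v j))"
    unfolding index_sum
    by (simp add: cinner_d v_def R_def cong: sum.cong_simp)
       (simp add: P_def linear_diff[OF bounded_linear.linear[OF bounded_linear_bwd]] bwd_cscale)
  show "(norm x)\<^sup>2 = (norm (R x))\<^sup>2 + (\<Sum>j\<in>{0..Suc m}. (cmod (cinner x (d j)))\<^sup>2)"
    unfolding index_sum norm_P[of x] norm_bwd[of "P x"] bessel_equality[of "bwd (P x)"]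
    by (simp add: cinner_d R_def cong: sum.cong_simp)
qed simp

lemma coord_P_0: "x \<in> N \<Longrightarrow> coord (P x) 0 = 0"
  using coord_0[of x] by (simp add: P_def)

text \<open>Near invariance provides some decomposition with unknown coefficients \<open>c\<close>.
  As \<open>N\<close> is orthogonal to the orthonormal \<open>u j\<close>, these are the inner
  products that \<open>R\<close> subtracts.\<close>

lemma R_in: 
  assumes "x \<in> N" shows "R x \<in> N"
proof -
  have "P x \<in> N" unfolding P_def by (intro csubspaceD(3,4)[OF sub] assms g)
  then obtain y c where y: "y \<in> N" "bwd (P x) = y + (\<Sum>j=1..m. cscale (c j) (u j))"
    using bwd_in coord_P_0[OF assms] by blast
  have "cinner (bwd (P x)) (u i) = c i" if "i \<in> {1..m}" for i
  proof -
    have "cinner (bwd (P x)) (u i) = (\<Sum>j=1..m. cinner (cscale (c j) (u j)) (u i))"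
      unfolding y(2) cinner_add_left cinner_sum_left orthogonal[OF y(1) that] by simp
    also have "\<dots> = (\<Sum>j=1..m. if j = i then c j else 0)"
      using that by (intro sum.cong) (auto simp: orthonormal)
    finally have "cinner (bwd (P x)) (u i) = \<dots>" .
    then show ?thesis using that by simp
  qed
  then have "R x = y" by (simp add: R_def y(2) cong: sum.cong_simp)
  then show ?thesis using y(1) by simp
qed

lemma funpow_R_in: "x \<in> N \<Longrightarrow> (R ^^ n) x \<in> N"
  by (induction n) (auto simp: R_in)

text \<open>The Taylor coefficients of k_j: step n of the iteration splits off the inner product of
  \<open>(R ^^ n) x\<close> with \<open>d j\<close>.\<close>

definition J :: "nat \<Rightarrow> ell2 \<Rightarrow> ell2" where
  "J j x = Abs_ell2 (\<lambda>n. cinner ((R ^^ n) x) (d j))"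

lemma coord_J: "j \<in> {0..Suc m} \<Longrightarrow> coord (J j x) n = cinner ((R ^^ n) x) (d j)"
  using summable_energy[of j x] by (simp add: J_def Abs_ell2_inverse)

text \<open>The last equation is the source of the invariance of K: applying \<open>R\<close> to
  \<open>x\<close> shifts every k_j backward.\<close>

lemma J_linear:
  assumes "j \<in> {0..Suc m}"
  shows "J j (x + y) = J j x + J j y" "J j (x - y) = J j x - J j y"
    "J j (cscale c x) = cscale c (J j x)" "J j 0 = 0" "J j (R x) = bwd (J j x)"
  using assms
  by (auto intro!: ell2_eqI simp: coord_J funpow_T_linear cinner_add_left cinner_diff_left funpow_swap1)

lemma J_outside:
  assumes "x \<in> N"
  shows "J (Suc m) x = 0"
  using coord_P_0[OF funpow_R_in[OF assms]] by (auto intro!: ell2_eqI simp: coord_J cinner_d)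

text \<open>This is the energy identity for n steps in the limit. Here
  \<open>funpow_tendsto_0\<close> does its work; boundedness of the iterates alone would give only
  an inequality.\<close>

lemma norm_J: "(norm x)\<^sup>2 = (\<Sum>j\<in>{0..Suc m}. (norm (J j x))\<^sup>2)"
proof -
  have "(\<lambda>n. (norm ((R ^^ n) x))\<^sup>2 + (\<Sum>j\<in>{0..Suc m}. \<Sum>k<n. (cmod (coord (J j x) k))\<^sup>2))
      \<longlonglongrightarrow> (norm (0 :: ell2))\<^sup>2 + (\<Sum>j\<in>{0..Suc m}. (norm (J j x))\<^sup>2)"
    unfolding norm_ell2_sq[of "J _ x"]
    by (intro tendsto_intros tendsto_sum funpow_tendsto_0 summable_LIMSEQ summable_coord)
  moreover have "(norm ((R ^^ n) x))\<^sup>2 + (\<Sum>j\<in>{0..Suc m}. \<Sum>k<n. (cmod (coord (J j x) k))\<^sup>2) = (norm x)\<^sup>2" for n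
    by (subst sum.swap) (simp add: energy_funpow[of x n] coord_J cong: sum.cong_simp)
  ultimately show ?thesis by (simp add: LIMSEQ_const_iff)
qed

lemma norm_J_in: "x \<in> N \<Longrightarrow> (norm x)\<^sup>2 = (\<Sum>j=0..m. (norm (J j x))\<^sup>2)"
  by (subst norm_J) (simp add: J_outside)

lemma bounded_linear_J:
  assumes "j \<in> {0..Suc m}"
  shows "bounded_linear (J j)"
proof (rule bounded_linear_intro[of _ 1])
  fix x
  have "(norm (J j x))\<^sup>2 \<le> (norm x)\<^sup>2"
    unfolding norm_J[of x] using assms by (intro member_le_sum) auto
  then show "norm (J j x) \<le> norm x * 1" by (simp add: power2_le_iff_abs_le)
qed (use assms in \<open>auto simp: J_linear scaleR_eq_cscale\<close>)

lemma of_ell2_step: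
  assumes "x \<in> N" "cmod z < 1"
  shows "of_ell2 x z = cinner x (d 0) * of_ell2 g z + z * (\<Sum>j=1..m. cinner x (d j) * of_ell2 (u j) z) + z * of_ell2 (R x) z"
proof -
  have x: "x = cscale (cinner x g) g + P x" by (simp add: P_def)
  have b: "bwd (P x) = R x + (\<Sum>j=1..m. cscale (cinner (bwd (P x)) (u j)) (u j))" by (simp add: R_def)
  have "of_ell2 x z = cinner x g * of_ell2 g z + of_ell2 (P x) z"
    by (subst (1) x) (simp add: of_ell2_add of_ell2_cscale fscale_def)
  also have "of_ell2 (P x) z = z * of_ell2 (bwd (P x)) z"
    using of_ell2_bwd_eq[OF assms(2), of "P x"] coord_P_0[OF assms(1)] by simp
  also have "of_ell2 (bwd (P x)) z = of_ell2 (R x) z + (\<Sum>j=1..m. cinner x (d j) * of_ell2 (u j) z)"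
    by (subst b) (simp add: of_ell2_add of_ell2_sum of_ell2_cscale fscale_def cinner_d cong: sum.cong_simp)
  finally show ?thesis by (simp add: cinner_d algebra_simps)
qed

text \<open>The steps telescope. The remainder z^n (R^n x)(z) vanishes already because the iterates
  are bounded and |z| < 1, so the pointwise formula is the easy half of the representation.\<close>

lemma of_ell2_eq:
  assumes "x \<in> N"
  shows "of_ell2 x z = of_ell2 (J 0 x) z * of_ell2 g z + z * (\<Sum>j=1..m. of_ell2 (J j x) z * of_ell2 (u j) z)"
proof (cases "cmod z < 1")
  case True
  define G where "G y = cinner y (d 0) * of_ell2 g z + z * (\<Sum>j=1..m. cinner y (d j) * of_ell2 (u j) z)" for y
  have step: "of_ell2 y z = G y + z * of_ell2 (R y) z" if "y \<in> N" for y
    unfolding G_def by (rule of_ell2_step[OF that True])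
  have partial: "(\<Sum>k<n. z ^ k * G ((R ^^ k) x)) = of_ell2 x z - z ^ n * of_ell2 ((R ^^ n) x) z" for n
    by (induction n) (simp_all add: step[OF funpow_R_in[OF assms]] algebra_simps)
  have "(\<lambda>n. z ^ n * of_ell2 ((R ^^ n) x) z) \<longlonglongrightarrow> 0"
  proof (rule Lim_null_comparison)
    show "\<forall>\<^sub>F n in sequentially. norm (z ^ n * of_ell2 ((R ^^ n) x) z) \<le> cmod z ^ n * (norm x / (1 - cmod z))"
    proof (intro always_eventually allI)
      fix n
      have "cmod (of_ell2 ((R ^^ n) x) z) \<le> norm ((R ^^ n) x) / (1 - cmod z)" by (rule norm_of_ell2_le[OF True])
      also have "\<dots> \<le> norm x / (1 - cmod z)" using True by (intro divide_right_mono norm_funpow_T_le) auto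
      finally show "norm (z ^ n * of_ell2 ((R ^^ n) x) z) \<le> cmod z ^ n * (norm x / (1 - cmod z))"
        unfolding norm_mult norm_power by (intro mult_left_mono) auto
    qed
    show "(\<lambda>n. cmod z ^ n * (norm x / (1 - cmod z))) \<longlonglongrightarrow> 0"
      using True by (intro tendsto_mult_left_zero LIMSEQ_power_zero) simp
  qed
  then have "(\<lambda>k. z ^ k * G ((R ^^ k) x)) sums of_ell2 x z"
    unfolding sums_def partial using tendsto_diff[OF tendsto_const, of _ 0 sequentially "of_ell2 x z"] by simp
  moreover have "(\<lambda>k. coord (J 0 x) k * z ^ k * of_ell2 g z + z * (\<Sum>j=1..m. coord (J j x) k * z ^ k * of_ell2 (u j) z)) sums
     (of_ell2 (J 0 x) z * of_ell2 g z + z * (\<Sum>j=1..m. of_ell2 (J j x) z * of_ell2 (u j) z))"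
    by (intro sums_add sums_mult sums_mult2 sums_sum of_ell2_sums True)
  moreover have "z ^ k * G ((R ^^ k) x) =
      coord (J 0 x) k * z ^ k * of_ell2 g z + z * (\<Sum>j=1..m. coord (J j x) k * z ^ k * of_ell2 (u j) z)" for k
    unfolding G_def by (simp add: coord_J algebra_simps sum_distrib_left cong: sum.cong_simp)
  ultimately show ?thesis by (simp add: sums_unique2)
qed (simp add: of_ell2_outside)

text \<open>The tuple (k_j) that belongs to \<open>x\<close>. The set \<open>A\<close> is {0..m} or
  {1..m}, according to the case, and tuples have to be 0 outside it.\<close>

definition model :: "nat set \<Rightarrow> ell2 \<Rightarrow> nat \<Rightarrow> complex \<Rightarrow> complex" where
  "model A x = (\<lambda>j. if j \<in> A then of_ell2 (J j x) else 0)"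

text \<open>On \<open>N\<close> the map \<open>model A\<close> preserves norms, the omitted
  components being 0. So a convergent sequence of images comes from a Cauchy sequence in
  \<open>N\<close>, whose limit lies in \<open>N\<close> because \<open>N\<close> is closed.\<close>

lemma model_closed_subspace:
  assumes A: "A \<subseteq> {0..m}" "\<And>x j. x \<in> N \<Longrightarrow> j \<in> {0..m} - A \<Longrightarrow> J j x = 0"
  shows "H2_vec_closed_subspace A (model A ` N)"
  unfolding H2_vec_closed_subspace_def
proof (intro conjI allI impI)
  have A_le: "j \<in> {0..Suc m}" if "j \<in> A" for j using A(1) that by auto
  have fin: "finite A" using A(1) finite_subset by blast
  show "model A ` N \<subseteq> H2_vec A" by (auto simp: H2_vec_def model_def)
  show "H2vec.subspace (model A ` N)"
    unfolding H2vec.subspace_def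
  proof (intro conjI ballI allI)
    have "model A 0 = 0" using A_le by (auto simp: model_def J_linear fun_eq_iff)
    then show "0 \<in> model A ` N" using csubspaceD(1)[OF sub] by (metis imageI)
  next
    fix k l assume "k \<in> model A ` N" "l \<in> model A ` N"
    then obtain x y where xy: "x \<in> N" "y \<in> N" "k = model A x" "l = model A y" by blast
    have "model A x + model A y = model A (x + y)"
      using A_le by (auto simp: model_def J_linear of_ell2_add fun_eq_iff)
    then show "k + l \<in> model A ` N" using xy csubspaceD(2)[OF sub] by auto
  next
    fix c k assume "k \<in> model A ` N"
    then obtain x where x: "x \<in> N" "k = model A x" by blast
    have "vscale c (model A x) = model A (cscale c x)"
      using A_le by (auto simp: model_def J_linear of_ell2_cscale vscale_def fscale_def fun_eq_iff)
    then show "vscale c k \<in> model A ` N" using x csubspaceD(3)[OF sub] by auto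
  qed
  fix X k assume "(\<forall>n. X n \<in> model A ` N) \<and> k \<in> H2_vec A \<and> (\<lambda>n. H2_vec_norm A (X n - k)) \<longlonglongrightarrow> 0"
  then have k: "k \<in> H2_vec A" and lim: "(\<lambda>n. H2_vec_norm A (X n - k)) \<longlonglongrightarrow> 0"
    and "\<forall>n. \<exists>x. x \<in> N \<and> X n = model A x" by auto
  then obtain x where x: "\<And>n. x n \<in> N" "\<And>n. X n = model A (x n)" by metis
  have "\<exists>y. k j = of_ell2 y" if "j \<in> A" for j
    using k that by (auto simp: H2_vec_def H2_eq_range_of_ell2)
  then obtain y where y: "\<And>j. j \<in> A \<Longrightarrow> k j = of_ell2 (y j)" by metis
  have "H2_vec_norm A (X n - k) = sqrt (\<Sum>j\<in>A. (norm (J j (x n) - y j))\<^sup>2)" for n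
    unfolding H2_vec_norm_def by (simp add: x(2) model_def y flip: of_ell2_diff cong: sum.cong_simp)
  then have lim0: "(\<lambda>n. sqrt (\<Sum>j\<in>A. (norm (J j (x n) - y j))\<^sup>2)) \<longlonglongrightarrow> 0"
    using lim by simp
  have Jlim: "(\<lambda>n. J j (x n)) \<longlonglongrightarrow> y j" if "j \<in> A" for j
  proof (rule Lim_transform_bound[THEN LIM_zero_cancel, OF _ lim0], intro always_eventually allI)
    fix n
    have "norm (J j (x n) - y j) = sqrt ((norm (J j (x n) - y j))\<^sup>2)" by simp
    also have "\<dots> \<le> sqrt (\<Sum>j\<in>A. (norm (J j (x n) - y j))\<^sup>2)"
      using that fin by (intro real_sqrt_le_mono member_le_sum) auto
    finally show "norm (J j (x n) - y j) \<le> norm (sqrt (\<Sum>j\<in>A. (norm (J j (x n) - y j))\<^sup>2))"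
      by (simp add: sum_nonneg)
  qed
  have nrm: "(norm z)\<^sup>2 = (\<Sum>j\<in>A. (norm (J j z))\<^sup>2)" if "z \<in> N" for z
    unfolding norm_J_in[OF that] using A that by (intro sum.mono_neutral_right) auto
  have "Cauchy x"
  proof (rule CauchyI)
    fix e :: real assume e: "e > 0"
    \<comment> \<open>The 1 added to the cardinality keeps the denominator positive and the final
      inequality strict when \<open>A\<close> is empty, which happens for {1..m} with m = 0. The 0
      inserted under \<open>Max\<close> below serves the same case.\<close>
    define \<epsilon> where "\<epsilon> = e / sqrt (real (card A) + 1)"
    have \<epsilon>: "\<epsilon> > 0" using e by (simp add: \<epsilon>_def add_nonneg_pos)
    have "\<exists>M. \<forall>p\<ge>M. \<forall>q\<ge>M. norm (J j (x p) - J j (x q)) < \<epsilon>" if "j \<in> A" for j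
      using CauchyD[OF LIMSEQ_imp_Cauchy[OF Jlim[OF that]] \<epsilon>] by blast
    then obtain M where M: "\<And>j p q. j \<in> A \<Longrightarrow> p \<ge> M j \<Longrightarrow> q \<ge> M j \<Longrightarrow> norm (J j (x p) - J j (x q)) < \<epsilon>"
      by metis
    have "norm (x p - x q) < e" if pq: "p \<ge> Max (insert 0 (M ` A))" "q \<ge> Max (insert 0 (M ` A))" for p q
    proof -
      have "(norm (x p - x q))\<^sup>2 = (\<Sum>j\<in>A. (norm (J j (x p) - J j (x q)))\<^sup>2)"
        using nrm[OF csubspaceD(4)[OF sub x(1) x(1)], of p q] A_le
        by (simp add: J_linear cong: sum.cong_simp)
      also have "\<dots> \<le> (\<Sum>j\<in>A. \<epsilon>\<^sup>2)"
      proof (intro sum_mono power_mono)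
        fix j assume "j \<in> A"
        then have "p \<ge> M j" "q \<ge> M j" using pq fin by (auto simp: Max_ge_iff intro: order_trans[rotated])
        then show "norm (J j (x p) - J j (x q)) \<le> \<epsilon>" using M[OF \<open>j \<in> A\<close>] less_imp_le by blast
      qed simp
      also have "\<dots> = real (card A) * \<epsilon>\<^sup>2" by simp
      also have "\<dots> < (real (card A) + 1) * \<epsilon>\<^sup>2" using \<epsilon> by simp
      also have "\<dots> = e\<^sup>2" by (simp add: \<epsilon>_def power_divide add_nonneg_pos)
      finally show ?thesis using e by (simp add: power2_less_imp_less)
    qed
    then show "\<exists>M. \<forall>p\<ge>M. \<forall>q\<ge>M. norm (x p - x q) < e" by blast
  qed
  then obtain x' where x': "x \<longlonglongrightarrow> x'" using Cauchy_convergent convergent_def by blast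
  have "x' \<in> N" using closed_sequentially[OF closed _ x'] x(1) by blast
  moreover have "k = model A x'"
  proof
    fix j
    show "k j = model A x' j"
    proof (cases "j \<in> A")
      case True
      have "(\<lambda>n. J j (x n)) \<longlonglongrightarrow> J j x'"
        by (rule bounded_linear.tendsto[OF bounded_linear_J[OF A_le[OF True]] x'])
      then show ?thesis using Jlim[OF True] True y by (auto simp: model_def dest: LIMSEQ_unique)
    next
      case False
      then show ?thesis using k by (simp add: H2_vec_def model_def)
    qed
  qed
  ultimately show "k \<in> model A ` N" by blast
qed

lemma bshift_invariant_model:
  assumes "A \<subseteq> {0..m}"
  shows "bshift_invariant (model A ` N)"
  unfolding bshift_invariant_def
proof
  fix k assume "k \<in> model A ` N"
  then obtain x where x: "x \<in> N" "k = model A x" by blast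
  \<comment> \<open>The components outside \<open>A\<close> are the zero function, which has to stay
    zero under \<open>bshift\<close>.\<close>
  have "bwd 0 = 0" by (rule ell2_eqI) simp
  then have "bshift (0 :: complex \<Rightarrow> complex) = 0" using bshift_of_ell2[of 0] by simp
  then have "(\<lambda>j. bshift (k j)) = model A (R x)"
    using assms by (auto simp: x model_def bshift_of_ell2 J_linear fun_eq_iff subset_iff)
  then show "(\<lambda>j. bshift (k j)) \<in> model A ` N" using R_in[OF x(1)] by blast
qed

lemma of_ell2_eq_model:
  assumes "x \<in> N" "{1..m} \<subseteq> A" "0 \<in> A \<or> g = 0"
  shows "of_ell2 x z = model A x 0 z * of_ell2 g z + z * (\<Sum>j=1..m. model A x j z * of_ell2 (u j) z)"
proof -
  have "(\<Sum>j=1..m. model A x j z * of_ell2 (u j) z) = (\<Sum>j=1..m. of_ell2 (J j x) z * of_ell2 (u j) z)"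
    using assms(2) by (intro sum.cong) (auto simp: model_def subset_iff)
  then show ?thesis using assms(3) of_ell2_eq[OF assms(1), of z] by (auto simp: model_def)
qed

lemma norm_model:
  assumes "x \<in> N" "A \<subseteq> {0..m}" "\<And>j. j \<in> {0..m} - A \<Longrightarrow> J j x = 0"
  shows "(norm x)\<^sup>2 = (\<Sum>j\<in>A. (H2_norm (model A x j))\<^sup>2)"
proof -
  have "(norm x)\<^sup>2 = (\<Sum>j\<in>A. (norm (J j x))\<^sup>2)"
    unfolding norm_J_in[OF assms(1)] using assms(2,3) by (intro sum.mono_neutral_right) auto
  then show ?thesis by (simp add: model_def cong: sum.cong_simp)
qed

end

section \<open>The representation for subspaces of H2\<close>

lemma near_invariance_vimage:
  assumes M: "H2_closed_subspace M" "H2_orthogonal M F" "bshift_into_sum M F"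
    and e: "H2_orthonormal_basis m e F"
    and u: "\<And>j. j \<in> {1..m} \<Longrightarrow> e j = of_ell2 (u j)" "\<And>j. j \<in> {1..m} \<Longrightarrow> e j \<in> F"
      "\<And>i j. i \<in> {1..m} \<Longrightarrow> j \<in> {1..m} \<Longrightarrow> cinner (u i) (u j) = (if i = j then 1 else 0)"
    and g: "of_ell2 g \<in> M" "g = 0 \<or> norm g = 1" "\<And>x. of_ell2 x \<in> M \<Longrightarrow> coord x 0 = cinner x g * coord g 0"
  shows "near_invariance (of_ell2 -` M) m g u"
proof
  show "csubspace (of_ell2 -` M)" "closed (of_ell2 -` M)" by (rule H2_closed_subspace_vimage[OF M(1)])+
  show "cinner x (u j) = 0" if "x \<in> of_ell2 -` M" "j \<in> {1..m}" for x j
    using M(2) that u(1,2)[OF that(2)] by (metis H2_inner_of_ell2 H2_orthogonal_def vimageE)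
  show "g \<in> of_ell2 -` M" using g(1) by simp
  show "g = 0 \<or> norm g = 1" by (rule g(2))
  show "coord x 0 = cinner x g * coord g 0" if "x \<in> of_ell2 -` M" for x using g(3) that by blast
  show "cinner (u i) (u j) = (if i = j then 1 else 0)" if "i \<in> {1..m}" "j \<in> {1..m}" for i j
    by (rule u(3)[OF that])
  fix x assume x: "x \<in> of_ell2 -` M" "coord x 0 = 0"
  then have "bshift (of_ell2 x) \<in> {g + h |g h. g \<in> M \<and> h \<in> F}"
    using M(3) by (simp add: bshift_into_sum_def of_ell2_at_0)
  then obtain y h where y: "of_ell2 (bwd x) = of_ell2 y + h" "of_ell2 y \<in> M" "h \<in> F"
    using H2_closed_subspace_vimage(3)[OF M(1)] unfolding bshift_of_ell2 by blast
  have "h \<in> H2fun.span (e ` {1..m})" using y(3) e by (simp add: H2_orthonormal_basis_def)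
  then obtain c where c: "h = (\<Sum>j=1..m. fscale (c j) (e j))"
    using H2fun_span_image[of "{1..m}" h e] by blast
  have "h = of_ell2 (\<Sum>j=1..m. cscale (c j) (u j))"
    by (rule ext) (simp add: c sum_fun_apply of_ell2_sum of_ell2_cscale u(1) cong: sum.cong_simp)
  with y(1) have "bwd x = y + (\<Sum>j=1..m. cscale (c j) (u j))" by (simp flip: of_ell2_add)
  with y(2) show "\<exists>y\<in>of_ell2 -` M. \<exists>c. bwd x = y + (\<Sum>j=1..m. cscale (c j) (u j))" by auto
qed

lemma represents_nonvanishing_exists:
  assumes M: "H2_closed_subspace M" "H2_orthogonal M F" "bshift_into_sum M F"
    and F: "H2_subspace_dim m F" "H2_orthonormal_basis m e F"
    and nz: "f \<in> M" "f 0 \<noteq> 0"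
  shows "\<exists>K. represents_nonvanishing m M e K"
proof -
  obtain g where ker: "of_ell2 g \<in> M" "normalized_kernel_at_0 M = of_ell2 g" "norm g = 1"
    "\<And>x. of_ell2 x \<in> M \<Longrightarrow> coord x 0 = cinner x g * coord g 0"
    using kernel_at_0_eq[OF M(1) nz] by metis
  obtain u where u: "\<And>j. j \<in> {1..m} \<Longrightarrow> e j = of_ell2 (u j)" "\<And>j. j \<in> {1..m} \<Longrightarrow> e j \<in> F"
    "\<And>i j. i \<in> {1..m} \<Longrightarrow> j \<in> {1..m} \<Longrightarrow> cinner (u i) (u j) = (if i = j then 1 else 0)"
    using orthonormal_basis_of_ell2[OF F] by metis
  interpret near_invariance "of_ell2 -` M" m g u
    using near_invariance_vimage[OF M F(2) u ker(1) _ ker(4)] ker(3) by blast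
  have rep: "rep_nonvanishing m (of_ell2 g) e (model {0..m} x) = of_ell2 x" if "of_ell2 x \<in> M" for x
    unfolding rep_nonvanishing_def
    by (rule ext, subst of_ell2_eq_model[of x "{0..m}"]) (use that u(1) in \<open>auto cong: sum.cong_simp\<close>)
  have "represents_nonvanishing m M e (model {0..m} ` (of_ell2 -` M))"
    unfolding represents_nonvanishing_def ker(2)
  proof (intro conjI ballI)
    show "H2_vec_closed_subspace {0..m} (model {0..m} ` of_ell2 -` M)"
      by (rule model_closed_subspace) auto
    show "bshift_invariant (model {0..m} ` of_ell2 -` M)" by (rule bshift_invariant_model) simp
    show "M = {rep_nonvanishing m (of_ell2 g) e k |k. k \<in> model {0..m} ` of_ell2 -` M}"
    proof (intro set_eqI iffI)
      fix h assume h: "h \<in> M"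
      then obtain x where "h = of_ell2 x" using H2_closed_subspace_vimage(3)[OF M(1)] by blast
      then show "h \<in> {rep_nonvanishing m (of_ell2 g) e k |k. k \<in> model {0..m} ` of_ell2 -` M}"
        using h rep[of x] by force
    qed (use rep in auto)
    fix k assume "k \<in> model {0..m} ` of_ell2 -` M"
    then obtain x where "of_ell2 x \<in> M" "k = model {0..m} x" by blast
    then show "(H2_norm (rep_nonvanishing m (of_ell2 g) e k))\<^sup>2 = (\<Sum>j=0..m. (H2_norm (k j))\<^sup>2)"
      using norm_model[of x "{0..m}"] by (simp add: rep)
  qed
  then show ?thesis by blast
qed

lemma represents_vanishing_exists:
  assumes M: "H2_closed_subspace M" "H2_orthogonal M F" "bshift_into_sum M F"
    and F: "H2_subspace_dim m F" "H2_orthonormal_basis m e F"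
    and van: "\<forall>f\<in>M. f 0 = 0"
  shows "\<exists>K. represents_vanishing m M e K"
proof -
  obtain u where u: "\<And>j. j \<in> {1..m} \<Longrightarrow> e j = of_ell2 (u j)" "\<And>j. j \<in> {1..m} \<Longrightarrow> e j \<in> F"
    "\<And>i j. i \<in> {1..m} \<Longrightarrow> j \<in> {1..m} \<Longrightarrow> cinner (u i) (u j) = (if i = j then 1 else 0)"
    using orthonormal_basis_of_ell2[OF F] by metis
  have "of_ell2 0 \<in> M" using csubspaceD(1)[OF H2_closed_subspace_vimage(1)[OF M(1)]] by simp
  moreover have "coord x 0 = cinner x 0 * coord 0 0" if "of_ell2 x \<in> M" for x
    using van that by (auto simp flip: of_ell2_at_0)
  ultimately interpret near_invariance "of_ell2 -` M" m 0 u
    using near_invariance_vimage[OF M F(2) u, of 0] by blast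
  \<comment> \<open>The only index left out is 0, and there \<open>d 0\<close> is \<open>g\<close>,
    which is 0 in this case.\<close>
  have J0: "J j x = 0" if "j \<in> {0..m} - {1..m}" for j x
  proof -
    have "j = 0" using that by auto
    then show ?thesis by (auto intro!: ell2_eqI simp: coord_J cinner_d)
  qed
  have rep: "rep_vanishing m e (model {1..m} x) = of_ell2 x" if "of_ell2 x \<in> M" for x
    unfolding rep_vanishing_def
    by (rule ext, subst of_ell2_eq_model[of x "{1..m}"]) (use that u(1) in \<open>auto cong: sum.cong_simp\<close>)
  have "represents_vanishing m M e (model {1..m} ` (of_ell2 -` M))"
    unfolding represents_vanishing_def
  proof (intro conjI ballI)
    show "H2_vec_closed_subspace {1..m} (model {1..m} ` of_ell2 -` M)"
      by (rule model_closed_subspace) (use J0 in auto)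
    show "bshift_invariant (model {1..m} ` of_ell2 -` M)" by (rule bshift_invariant_model) auto
    show "M = {rep_vanishing m e k |k. k \<in> model {1..m} ` of_ell2 -` M}"
    proof (intro set_eqI iffI)
      fix h assume h: "h \<in> M"
      then obtain x where "h = of_ell2 x" using H2_closed_subspace_vimage(3)[OF M(1)] by blast
      then show "h \<in> {rep_vanishing m e k |k. k \<in> model {1..m} ` of_ell2 -` M}"
        using h rep[of x] by force
    qed (use rep in auto)
    fix k assume "k \<in> model {1..m} ` of_ell2 -` M"
    then obtain x where x: "of_ell2 x \<in> M" "k = model {1..m} x" by blast
    have "(norm x)\<^sup>2 = (\<Sum>j=1..m. (H2_norm (model {1..m} x j))\<^sup>2)"
      by (rule norm_model) (use x(1) J0 in auto)
    then show "(H2_norm (rep_vanishing m e k))\<^sup>2 = (\<Sum>j=1..m. (H2_norm (k j))\<^sup>2)"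
      by (simp only: x(2) rep[OF x(1)] H2_norm_of_ell2)
  qed
  then show ?thesis by blast
qed

section \<open>The converse: near invariance from a representation\<close>

lemma bshift_rep_nonvanishing:
  assumes H2: "f0 \<in> H2" "\<And>j. k j \<in> H2" "\<And>j. j \<in> {1..m} \<Longrightarrow> e j \<in> H2" and k0: "k 0 0 = 0"
  shows "bshift (rep_nonvanishing m f0 e k) =
    rep_nonvanishing m f0 e (\<lambda>j. bshift (k j)) + (\<Sum>j=1..m. fscale (k j 0) (e j))"
proof
  fix z
  define S where "S z = (\<Sum>j=1..m. k j z * e j z)" for z
  let ?f = "rep_nonvanishing m f0 e k"
  have f: "?f = (\<lambda>z. k 0 z * f0 z + z * S z)" by (simp add: rep_nonvanishing_def S_def)
  show "bshift ?f z = (rep_nonvanishing m f0 e (\<lambda>j. bshift (k j)) + (\<Sum>j=1..m. fscale (k j 0) (e j))) z"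
  proof (cases "z \<in> ball 0 1")
    case False
    then have "f0 z = 0" "\<And>j. j \<in> {1..m} \<Longrightarrow> e j z = 0" using H2 by (auto simp: H2_def)
    then show ?thesis using False
      by (simp add: bshift_def rep_nonvanishing_def sum_fun_apply fscale_def cong: sum.cong_simp)
  next
    case True
    show ?thesis
    proof (cases "z = 0")
      case z: True
      have holo: "h holomorphic_on ball 0 1" if "h \<in> H2" for h using that by (simp add: H2_def)
      have diff: "(h has_field_derivative deriv h 0) (at 0)" if "h holomorphic_on ball 0 1" for h :: "complex \<Rightarrow> complex"
        using holomorphic_derivI[OF that] by simp
      have "S holomorphic_on ball 0 1"
        unfolding S_def[abs_def] by (intro holomorphic_intros holo H2) auto
      \<comment> \<open>At 0 \<open>bshift\<close> is a derivative, so the product rule takes the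
        place of division by z; \<open>k 0 0 = 0\<close> removes the term with the derivative of
        \<open>f0\<close>.\<close>
      then have "(?f has_field_derivative (deriv (k 0) 0 * f0 0 + deriv f0 0 * k 0 0) + (1 * S 0 + deriv S 0 * 0)) (at 0)"
        unfolding f by (intro DERIV_add DERIV_mult[OF diff[OF holo[OF H2(2)]] diff[OF holo[OF H2(1)]]]
            DERIV_mult[OF DERIV_ident] diff)
      then have "deriv ?f 0 = deriv (k 0) 0 * f0 0 + S 0" using k0 by (simp add: DERIV_imp_deriv)
      then show ?thesis
        by (simp add: z bshift_def rep_nonvanishing_def S_def sum_fun_apply fscale_def)
    next
      case z: False
      \<comment> \<open>Splitting k_j into its constant term and z times its backward shift: after
        division by z, the constants of k_1, ..., k_m leave a combination of the \<open>e j\<close>,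
        that is, the part in the defect space.\<close>
      have "k j z = z * bshift (k j) z + k j 0" for j using z True by (simp add: bshift_def)
      then have "S z = z * (\<Sum>j=1..m. bshift (k j) z * e j z) + (\<Sum>j=1..m. k j 0 * e j z)"
        unfolding S_def by (simp add: sum_distrib_left distrib_right sum.distrib mult.assoc)
      moreover have "?f 0 = 0" using k0 by (simp add: f)
      then have "bshift ?f z = bshift (k 0) z * f0 z + S z"
        using z True k0 by (simp add: bshift_def f field_simps)
      ultimately show ?thesis
        by (simp add: rep_nonvanishing_def sum_fun_apply fscale_def)
    qed
  qed
qed

text \<open>Both cases are instances of this: the vanishing one has \<open>f0 = 0\<close>. The last
  assumption holds in one case because f_0(0) is not 0, in the other because the component with
  index 0 is the zero function.\<close>

lemma nearly_invariant_of_rep: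
  assumes M: "H2_closed_subspace M" "H2_orthogonal M F"
    and F: "H2_subspace_dim m F" "H2_orthonormal_basis m e F"
    and K: "K \<subseteq> H2_vec A" "bshift_invariant K" "M = {rep_nonvanishing m f0 e k |k. k \<in> K}"
    and f0: "f0 \<in> H2" "\<And>k. k \<in> K \<Longrightarrow> rep_nonvanishing m f0 e k 0 = 0 \<Longrightarrow> k 0 0 = 0"
  shows "nearly_invariant_defect m M"
  unfolding nearly_invariant_defect_def
proof (intro conjI exI)
  show "H2_closed_subspace M" "H2_subspace_dim m F" by fact+
  obtain u where u: "\<And>j. j \<in> {1..m} \<Longrightarrow> e j = of_ell2 (u j)" "\<And>j. j \<in> {1..m} \<Longrightarrow> e j \<in> F"
    using orthonormal_basis_of_ell2[OF F] by metis
  have subF: "H2fun.subspace F" using F(1) by (simp add: H2_subspace_dim_def)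
  have subM: "H2fun.subspace M" using M(1) by (simp add: H2_closed_subspace_def)
  \<comment> \<open>The definition of defect asks for a direct sum; a function in both spaces is
    orthogonal to itself.\<close>
  have "f = 0" if f: "f \<in> M" "f \<in> F" for f
  proof -
    obtain x where x: "f = of_ell2 x" using H2_closed_subspace_vimage(3)[OF M(1) f(1)] by blast
    have "H2_inner f f = 0" using M(2) f by (auto simp: H2_orthogonal_def)
    then show ?thesis by (simp add: x cinner_self)
  qed
  then show "M \<inter> F = {0}" using H2fun.subspace_0[OF subF] H2fun.subspace_0[OF subM] by auto
  have vec: "k j \<in> H2" if "k \<in> K" for k j
  proof (cases "j \<in> A")
    case False
    then have "k j = of_ell2 0" using K(1) that by (auto simp: H2_vec_def)
    then show ?thesis by (simp only: of_ell2_in_H2)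
  qed (use K(1) that in \<open>auto simp: H2_vec_def\<close>)
  show "bshift_into_sum M F"
    unfolding bshift_into_sum_def
  proof (intro ballI impI)
    fix f assume "f \<in> M" "f 0 = 0"
    then obtain k where k: "k \<in> K" "f = rep_nonvanishing m f0 e k" using K(3) by blast
    then have "k 0 0 = 0" using f0(2) \<open>f 0 = 0\<close> by blast
    then have "bshift f = rep_nonvanishing m f0 e (\<lambda>j. bshift (k j)) + (\<Sum>j=1..m. fscale (k j 0) (e j))"
      unfolding k(2) using bshift_rep_nonvanishing[OF f0(1) vec[OF k(1)], of m e] u(1) by simp
    moreover have "(\<lambda>j. bshift (k j)) \<in> K" using K(2) k(1) by (simp add: bshift_invariant_def)
    then have "rep_nonvanishing m f0 e (\<lambda>j. bshift (k j)) \<in> M" using K(3) by blast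
    moreover have "(\<Sum>j=1..m. fscale (k j 0) (e j)) \<in> F"
      by (intro H2fun.subspace_sum H2fun.subspace_scale subF u(2))
    ultimately show "bshift f \<in> {g + h |g h. g \<in> M \<and> h \<in> F}" by blast
  qed
qed

theorem theorem3p2:
  fixes m :: nat and M :: "(complex \<Rightarrow> complex) set"
  assumes "H2_closed_subspace M"
  shows
    "(nearly_invariant_defect m M \<longrightarrow>
        (\<forall>F e. H2_subspace_dim m F \<and> H2_orthogonal M F \<and> bshift_into_sum M F \<and>
               H2_orthonormal_basis m e F \<longrightarrow>
           ((\<exists>f\<in>M. f 0 \<noteq> 0) \<longrightarrow> (\<exists>K. represents_nonvanishing m M e K)) \<and>
           ((\<forall>f\<in>M. f 0 = 0) \<longrightarrow> (\<exists>K. represents_vanishing m M e K))))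
     \<and>
     ((\<exists>F e K. H2_subspace_dim m F \<and> H2_orthogonal M F \<and> H2_orthonormal_basis m e F \<and>
        (((\<exists>f\<in>M. f 0 \<noteq> 0) \<and> represents_nonvanishing m M e K) \<or>
         represents_vanishing m M e K))
      \<longrightarrow> nearly_invariant_defect m M)"
proof (intro conjI impI allI)
  fix F e
  assume "H2_subspace_dim m F \<and> H2_orthogonal M F \<and> bshift_into_sum M F \<and> H2_orthonormal_basis m e F"
  then have F: "H2_subspace_dim m F" "H2_orthonormal_basis m e F" "H2_orthogonal M F" "bshift_into_sum M F"
    by auto
  show "\<exists>K. represents_nonvanishing m M e K" if "\<exists>f\<in>M. f 0 \<noteq> 0"
    using represents_nonvanishing_exists[OF assms F(3,4,1,2)] that by blast
  show "\<exists>K. represents_vanishing m M e K" if "\<forall>f\<in>M. f 0 = 0"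
    using represents_vanishing_exists[OF assms F(3,4,1,2) that] .
next
  assume "\<exists>F e K. H2_subspace_dim m F \<and> H2_orthogonal M F \<and> H2_orthonormal_basis m e F \<and>
        (((\<exists>f\<in>M. f 0 \<noteq> 0) \<and> represents_nonvanishing m M e K) \<or> represents_vanishing m M e K)"
  then obtain F e K where F: "H2_subspace_dim m F" "H2_orthonormal_basis m e F" "H2_orthogonal M F"
    and K: "((\<exists>f\<in>M. f 0 \<noteq> 0) \<and> represents_nonvanishing m M e K) \<or> represents_vanishing m M e K"
    by blast
  from K show "nearly_invariant_defect m M"
  proof (elim disjE conjE bexE)
    fix f assume f: "f \<in> M" "f 0 \<noteq> 0" and "represents_nonvanishing m M e K"
    then have K: "K \<subseteq> H2_vec {0..m}" "bshift_invariant K"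
        "M = {rep_nonvanishing m (normalized_kernel_at_0 M) e k |k. k \<in> K}"
      by (auto simp only: represents_nonvanishing_def H2_vec_closed_subspace_def)
    obtain g where g: "normalized_kernel_at_0 M = of_ell2 g" "coord g 0 \<noteq> 0"
      using kernel_at_0_eq[OF assms f] by metis
    show ?thesis
    proof (rule nearly_invariant_of_rep[OF assms F(3,1,2) K])
      show "normalized_kernel_at_0 M \<in> H2" by (simp add: g)
      fix k assume "rep_nonvanishing m (normalized_kernel_at_0 M) e k 0 = 0"
      then show "k 0 0 = 0" using g by (simp add: rep_nonvanishing_def of_ell2_at_0)
    qed
  next
    assume "represents_vanishing m M e K"
    then have K: "K \<subseteq> H2_vec {1..m}" "bshift_invariant K" "M = {rep_vanishing m e k |k. k \<in> K}"
      by (auto simp only: represents_vanishing_def H2_vec_closed_subspace_def)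
    have rep: "rep_vanishing m e k = rep_nonvanishing m (of_ell2 0) e k" for k
      by (simp add: rep_vanishing_def rep_nonvanishing_def)
    show ?thesis
    proof (rule nearly_invariant_of_rep[OF assms F(3,1,2) K[unfolded rep]])
      \<comment> \<open>Index 0 lies outside {1..m}, where tuples are zero by convention.\<close>
      show "k 0 0 = 0" if "k \<in> K" for k using K(1) that by (auto simp: H2_vec_def)
    qed (rule of_ell2_in_H2)
  qed
qed

end
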